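(* (Continuous-valued gambling.) Consider repeated bets on a continuous-valued random variable $X$ by a gambler who has side information $Y$, where the rounds $(X_1,Y_1),\dots,(X_n,Y_n)$ are i.i.d. copies of $(X,Y)$. The gambler's capital after $n$ rounds is $S_n=\prod_{i=1}^n b_{X|Y}(X_i|Y_i)\,o_X(X_i)$, where the betting strategy $b_{X|Y}(x|y)=b_{X|y}(x)$ and the odds $o_X(x)$ are functions of the continuous variable $x$, and the betting strategy satisfies $\int_{\mathcal{X}} b_{X|y}(x)\,dx=1$ for all $y\in\mathcal{Y}$. (a) The optimal betting strategy, i.e. the one maximizing $E[\log S_n]$, is $b^*_{X|Y}(x|y)=f_{X|Y}(x|y)$. (b) If the bet is fair, i.e. $o_X(x)=1/f_X(x)$, then the maximal wealth growth rate is $\mathcal{W}^*=I(X;Y)$. (c) If the bet is fair and for each $y$ the function $b_{X|y}$ is limited to some set $\mathcal{B}$ of possible betting functions, then the maximal wealth growth rate is $$\mathcal{W}^*=\max_{b_{X|Y}\in\mathcal{B}}\frac1nE[\log S_n]=I(X;Y)-\int_{\mathcal{Y}} f_Y(y)\min_{b_{X|y}\in\mathcal{B}}D(f_{X|Y}(\cdot|y)||b_{X|y})\,dy,$$ and for each $y$ the optimal $b_{X|y}\in\mathcal{B}$ is the one that minimizes $D(f_{X|Y}(\cdot|y)||b_{X|y})$.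
   Context: $X$ takes values in $\mathcal{X}$ and $Y$ in $\mathcal{Y}$; $f_X$ and $f_Y$ are the probability density functions (PDFs) of $X$ and $Y$, and $f_{X|Y}$ is the conditional PDF of $X$ given $Y$. The gambler starts with capital $S_0=1$, observes $Y_i$ before betting on $X_i$, and invests all of the capital in each round; the normalization of $b_{X|y}$ expresses this. Betting strategies are nonnegative, describing how the capital is distributed over the possible outcomes. The wealth growth rate is $\mathcal{W}=\frac1nE[\log S_n]$, and $\mathcal{W}^*$ denotes its maximum over the allowed betting strategies. $I(X;Y)=E\big[\log\frac{f_{X|Y}(X|Y)}{f_X(X)}\big]$ is Shannon's mutual information and $D(f||g)=\int f(x)\log\frac{f(x)}{g(x)}\,dx$ is the Kullback-Leibler divergence.
   Formalization: In (c) it is assumed that some jointly measurable strategy with values in B attains the minimal divergence for almost every y, and that I(X;Y) and the subtracted integral are not both infinite; otherwise the stated max, min or difference may fail to exist. *)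

theory Defs
  imports "HOL-Probability.Probability"
begin

section \<open>Extended-real logarithm and integral\<close>

text \<open>
  The library's \<open>ln 0\<close> is \<open>0\<close> and its Bochner integral of a non-integrable function is \<open>0\<close>.
  Maximising an expected logarithm with these values would be wrong: a strategy that is ruined with
  positive probability has \<open>E[log S\<^sub>n] = -\<infinity>\<close>. Hence both are taken in the extended reals.
\<close>

definition elog :: "real \<Rightarrow> real \<Rightarrow> ereal" where
  "elog \<beta> x = (if 0 < x then ereal (log \<beta> x) else - \<infinity>)"

text \<open>
  The integral is \<open>\<integral>f\<^sup>+ - \<integral>f\<^sup>-\<close>; it is \<open>-\<infinity>\<close> whenever \<open>\<integral>f\<^sup>- = \<infinity>\<close>, which includes the undefined
  case \<open>\<infinity> - \<infinity>\<close>.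
\<close>

definition ereal_integral :: "'a measure \<Rightarrow> ('a \<Rightarrow> ereal) \<Rightarrow> ereal" where
  "ereal_integral M f =
     (if (\<integral>\<^sup>+x. e2ennreal (- f x) \<partial>M) = \<infinity> then - \<infinity>
      else enn2ereal (\<integral>\<^sup>+x. e2ennreal (f x) \<partial>M) - enn2ereal (\<integral>\<^sup>+x. e2ennreal (- f x) \<partial>M))"

lemma ereal_integral_cong_AE:
  assumes "AE x in M. f x = g x"
  shows "ereal_integral M f = ereal_integral M g"
proof -
  have "(\<integral>\<^sup>+x. e2ennreal (f x) \<partial>M) = (\<integral>\<^sup>+x. e2ennreal (g x) \<partial>M)"
    and "(\<integral>\<^sup>+x. e2ennreal (- f x) \<partial>M) = (\<integral>\<^sup>+x. e2ennreal (- g x) \<partial>M)"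
    using assms by (auto intro!: nn_integral_cong_AE elim!: eventually_mono)
  then show ?thesis
    by (simp add: ereal_integral_def)
qed

lemma ereal_integral_eq_integral:
  fixes g :: "'a \<Rightarrow> real"
  assumes g: "integrable M g"
  shows "ereal_integral M (\<lambda>x. ereal (g x)) = ereal (\<integral>x. g x \<partial>M)"
proof -
  have e: "e2ennreal (ereal r) = ennreal r" for r
    by (simp add: ennreal.abs_eq e2ennreal_def max_def)
  have p: "(\<integral>\<^sup>+x. ennreal (g x) \<partial>M) \<noteq> \<infinity>" and n: "(\<integral>\<^sup>+x. ennreal (- g x) \<partial>M) \<noteq> \<infinity>"
    using g by (auto simp: real_integrable_def)
  have "enn2ereal a - enn2ereal b = ereal (enn2real a - enn2real b)"
    if "a \<noteq> \<infinity>" "b \<noteq> \<infinity>" for a b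
    using that by (cases a; cases b) auto
  then show ?thesis
    using p n by (simp add: ereal_integral_def e real_lebesgue_integral_def[OF g])
qed

section \<open>Information measures\<close>

text \<open>
  Writing \<open>log f - log g\<close> for \<open>log (f / g)\<close> gives the integrand the usual values \<open>0\<close> where
  \<open>f = 0\<close> and \<open>\<infinity>\<close> where \<open>f > 0 = g\<close>.
\<close>

definition KL_div :: "real \<Rightarrow> 'a measure \<Rightarrow> ('a \<Rightarrow> real) \<Rightarrow> ('a \<Rightarrow> real) \<Rightarrow> ereal" where
  "KL_div \<beta> S f g = ereal_integral S (\<lambda>x. ereal (f x) * (elog \<beta> (f x) - elog \<beta> (g x)))"

definition mutual_info ::
  "real \<Rightarrow> 'w measure \<Rightarrow> ('w \<Rightarrow> 'a) \<Rightarrow> ('w \<Rightarrow> 'b) \<Rightarrow> ('a \<Rightarrow> real) \<Rightarrow> ('b \<Rightarrow> 'a \<Rightarrow> real) \<Rightarrow> ereal" where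
  "mutual_info \<beta> M X Y fX fXY = ereal_integral M (\<lambda>w. elog \<beta> (fXY (Y w) (X w) / fX (X w)))"

text \<open>
  The library's \<open>KL_divergence\<close> and \<open>mutual_information\<close> are real-valued and meaningful only in the
  absolutely continuous, integrable case, where the notions above agree with them.
\<close>

lemma KL_div_eq_KL_divergence:
  fixes f g :: "'a \<Rightarrow> real"
  assumes "sigma_finite_measure S" "1 < \<beta>"
    and f: "f \<in> borel_measurable S" "AE x in S. 0 \<le> f x"
    and g: "g \<in> borel_measurable S" "AE x in S. 0 \<le> g x"
    and ac: "AE x in S. g x = 0 \<longrightarrow> f x = 0"
    and int: "integrable S (\<lambda>x. f x * log \<beta> (f x / g x))"
  shows "KL_div \<beta> S f g = ereal (KL_divergence \<beta> (density S g) (density S f))"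
proof -
  have "AE x in S. ereal (f x) * (elog \<beta> (f x) - elog \<beta> (g x)) = ereal (f x * log \<beta> (f x / g x))"
    using f(2) g(2) ac
  proof eventually_elim
    case (elim x)
    then show ?case
    proof (cases "f x = 0")
      case True
      then show ?thesis by (simp flip: zero_ereal_def)
    next
      case False
      with elim have "0 < f x" "0 < g x" by (auto simp: less_le)
      then show ?thesis
        using \<open>1 < \<beta>\<close> by (simp add: elog_def log_divide)
    qed
  qed
  then have "KL_div \<beta> S f g = ereal (\<integral>x. f x * log \<beta> (f x / g x) \<partial>S)"
    unfolding KL_div_def ereal_integral_eq_integral[OF int, symmetric]
    by (rule ereal_integral_cong_AE)
  then show ?thesis
    using sigma_finite_measure.KL_density_density[OF assms(1,2) g f ac] by simp
qed

section \<open>Betting on a continuous random variable\<close>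

abbreviation lborel_on :: "'a::euclidean_space set \<Rightarrow> 'a measure" where
  "lborel_on A \<equiv> restrict_space lborel A"

text \<open>In the next definition the value \<open>1\<close> of the Bochner integral entails integrability.\<close>

definition betting_functions :: "'a measure \<Rightarrow> ('a \<Rightarrow> real) set" where
  "betting_functions S =
     {g \<in> borel_measurable S. (\<forall>x\<in>space S. 0 \<le> g x) \<and> (\<integral>x. g x \<partial>S) = 1}"

text \<open>\<open>b y x\<close> stands for \<open>b\<^bsub>X|Y\<^esub>(x|y)\<close>, so that \<open>b y\<close> is the function \<open>b\<^bsub>X|y\<^esub>\<close>.\<close>

definition strategies_in :: "'a measure \<Rightarrow> 'b measure \<Rightarrow> ('a \<Rightarrow> real) set \<Rightarrow> ('b \<Rightarrow> 'a \<Rightarrow> real) set" where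
  "strategies_in S T B =
     {b. (\<lambda>(x, y). b y x) \<in> borel_measurable (S \<Otimes>\<^sub>M T) \<and> (\<forall>y\<in>space T. b y \<in> B)}"

abbreviation strategies :: "'a measure \<Rightarrow> 'b measure \<Rightarrow> ('b \<Rightarrow> 'a \<Rightarrow> real) set" where
  "strategies S T \<equiv> strategies_in S T (betting_functions S)"

definition pdf :: "'w measure \<Rightarrow> 'a measure \<Rightarrow> ('w \<Rightarrow> 'a) \<Rightarrow> ('a \<Rightarrow> real) \<Rightarrow> bool" where
  "pdf M S X f \<longleftrightarrow> distributed M S X (\<lambda>x. ennreal (f x)) \<and> (\<forall>x\<in>space S. 0 \<le> f x)"

text \<open>
  A conditional PDF of \<open>X\<close> given \<open>Y\<close> is a jointly measurable version \<open>fXY y x\<close> that is a PDF in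
  \<open>x\<close> for \<^emph>\<open>every\<close> \<open>y\<close>, also where \<open>fY y = 0\<close>.
\<close>

definition conditional_pdf ::
  "'w measure \<Rightarrow> 'a measure \<Rightarrow> 'b measure \<Rightarrow> ('w \<Rightarrow> 'a) \<Rightarrow> ('w \<Rightarrow> 'b) \<Rightarrow> ('b \<Rightarrow> real) \<Rightarrow>
     ('b \<Rightarrow> 'a \<Rightarrow> real) \<Rightarrow> bool" where
  "conditional_pdf M S T X Y fY fXY \<longleftrightarrow>
     (\<lambda>(x, y). fXY y x) \<in> borel_measurable (S \<Otimes>\<^sub>M T) \<and>
     (\<forall>y\<in>space T. (\<forall>x\<in>space S. 0 \<le> fXY y x) \<and> (\<integral>x. fXY y x \<partial>S) = 1) \<and>
     pdf M (S \<Otimes>\<^sub>M T) (\<lambda>w. (X w, Y w)) (\<lambda>(x, y). fXY y x * fY y)"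

lemma mutual_info_eq_mutual_information:
  assumes M: "prob_space M" and "1 < \<beta>"
    and S: "sigma_finite_measure S" and T: "sigma_finite_measure T"
    and X: "pdf M S X fX" and Y: "pdf M T Y fY" and XY: "conditional_pdf M S T X Y fY fXY"
    and int: "integrable M (\<lambda>w. log \<beta> (fXY (Y w) (X w) / fX (X w)))"
  shows "mutual_info \<beta> M X Y fX fXY = ereal (prob_space.mutual_information M \<beta> S T X Y)"
proof -
  interpret information_space M \<beta>
    using M \<open>1 < \<beta>\<close> by (simp add: information_space_def information_space_axioms_def)
  let ?P = "S \<Otimes>\<^sub>M T"
  let ?D = "\<lambda>z. fXY (snd z) (fst z) * fY (snd z)"
  let ?l = "\<lambda>z. log \<beta> (fXY (snd z) (fst z) / fX (fst z))"
  have dX: "distributed M S X (\<lambda>x. ennreal (fX x))" and X0: "\<And>x. x \<in> space S \<Longrightarrow> 0 \<le> fX x"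
    using X by (auto simp: pdf_def)
  have dY: "distributed M T Y (\<lambda>x. ennreal (fY x))" and Y0: "\<And>y. y \<in> space T \<Longrightarrow> 0 \<le> fY y"
    using Y by (auto simp: pdf_def)
  have dXY: "distributed M ?P (\<lambda>w. (X w, Y w)) (\<lambda>z. ennreal (?D z))"
    and D0: "\<And>z. z \<in> space ?P \<Longrightarrow> 0 \<le> ?D z"
    and c0: "\<And>x y. x \<in> space S \<Longrightarrow> y \<in> space T \<Longrightarrow> 0 \<le> fXY y x"
    and mc: "(\<lambda>z. fXY (snd z) (fst z)) \<in> borel_measurable ?P"
    using XY by (auto simp: conditional_pdf_def pdf_def case_prod_beta)
  have mX: "fX \<in> borel_measurable S" and mY: "fY \<in> borel_measurable T"
    using distributed_real_measurable[OF X0 dX] distributed_real_measurable[OF Y0 dY] by auto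
  have mD: "?D \<in> borel_measurable ?P"
    using distributed_real_measurable[OF D0 dXY] .
  have ml: "?l \<in> borel_measurable ?P"
    using mc mX by measurable
  have zX: "AE z in ?P. fX (fst z) = 0 \<longrightarrow> ?D z = 0"
    by (rule subdensity_real[OF measurable_fst dXY dX]) (use X0 D0 in \<open>auto simp: space_pair_measure\<close>)
  have mxy: "(\<lambda>w. (X w, Y w)) \<in> measurable M ?P"
    using dXY by (simp add: distributed_def)
  have "AE z in distr M ?P (\<lambda>w. (X w, Y w)). 0 < fXY (snd z) (fst z) \<and> 0 < fX (fst z)"
    unfolding distributed_distr_eq_density[OF dXY]
    using zX AE_space[of ?P] mD
    by (subst AE_density)
       (auto elim!: eventually_elim2 simp: less_le space_pair_measure X0 c0)
  then have "AE w in M. 0 < fXY (Y w) (X w) \<and> 0 < fX (X w)"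
    using AE_distrD[OF mxy] by fastforce
  then have "AE w in M. elog \<beta> (fXY (Y w) (X w) / fX (X w)) =
      ereal (log \<beta> (fXY (Y w) (X w) / fX (X w)))"
    by eventually_elim (simp add: elog_def)
  then have "mutual_info \<beta> M X Y fX fXY = ereal (\<integral>w. ?l (X w, Y w) \<partial>M)"
    unfolding mutual_info_def using ereal_integral_eq_integral[OF int]
    by (simp add: ereal_integral_cong_AE)
  also have "(\<integral>w. ?l (X w, Y w) \<partial>M) = (\<integral>z. ?D z * ?l z \<partial>?P)"
    using distributed_integral[OF dXY ml D0] by simp
  also have "\<dots> = (\<integral>z. ?D z * log \<beta> (?D z / (fX (fst z) * fY (snd z))) \<partial>?P)"
    by (intro Bochner_Integration.integral_cong) auto
  also have "\<dots> = mutual_information \<beta> S T X Y"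
    by (rule mutual_information_distr[OF S T dX X0 dY Y0 dXY, symmetric])
       (auto simp: X0 Y0 c0 D0[simplified])
  finally show ?thesis .
qed

definition wealth ::
  "(nat \<Rightarrow> 'w \<Rightarrow> 'a) \<Rightarrow> (nat \<Rightarrow> 'w \<Rightarrow> 'b) \<Rightarrow> ('a \<Rightarrow> real) \<Rightarrow> nat \<Rightarrow> ('b \<Rightarrow> 'a \<Rightarrow> real) \<Rightarrow> 'w \<Rightarrow> real" where
  "wealth Xs Ys odds n b w = (\<Prod>i=1..n. b (Ys i w) (Xs i w) * odds (Xs i w))"

definition expected_log_wealth ::
  "real \<Rightarrow> 'w measure \<Rightarrow> (nat \<Rightarrow> 'w \<Rightarrow> 'a) \<Rightarrow> (nat \<Rightarrow> 'w \<Rightarrow> 'b) \<Rightarrow> ('a \<Rightarrow> real) \<Rightarrow> nat \<Rightarrow>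
     ('b \<Rightarrow> 'a \<Rightarrow> real) \<Rightarrow> ereal" where
  "expected_log_wealth \<beta> M Xs Ys odds n b =
     ereal_integral M (\<lambda>w. elog \<beta> (wealth Xs Ys odds n b w))"

definition growth_rate ::
  "real \<Rightarrow> 'w measure \<Rightarrow> (nat \<Rightarrow> 'w \<Rightarrow> 'a) \<Rightarrow> (nat \<Rightarrow> 'w \<Rightarrow> 'b) \<Rightarrow> ('a \<Rightarrow> real) \<Rightarrow> nat \<Rightarrow>
     ('b \<Rightarrow> 'a \<Rightarrow> real) \<Rightarrow> ereal" where
  "growth_rate \<beta> M Xs Ys odds n b =
     ereal (1 / real n) * expected_log_wealth \<beta> M Xs Ys odds n b"

definition is_maximum :: "'v::order set \<Rightarrow> 'v \<Rightarrow> bool" where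
  "is_maximum V v \<longleftrightarrow> v \<in> V \<and> (\<forall>u\<in>V. u \<le> v)"

end

theory Submission
  imports Defs
begin

text \<open>
  By independence the growth rate of a strategy \<open>b\<close> is the expected logarithmic gain of a single
  round, \<open>G(b) = E[log (b(X|Y) o(X))]\<close>; this includes the value \<open>-\<infinity>\<close>, since an infinite negative
  part in one round cannot be compensated by the other, independent rounds. Subtracting,
  \<open>G(f\<^bsub>X|Y\<^esub>) - G(b) = E[log (f\<^bsub>X|Y\<^esub> / b)] = \<integral> f\<^sub>Y(y) D(f\<^bsub>X|Y\<^esub>(\<cdot>|y) || b\<^bsub>X|y\<^esub>) dy\<close>, which is nonnegative
  by Gibbs' inequality and vanishes only if \<open>b = f\<^bsub>X|Y\<^esub>\<close> almost everywhere. For fair odds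
  \<open>G(f\<^bsub>X|Y\<^esub>) = I(X;Y)\<close>, so that maximising \<open>G\<close> over a restricted set of betting functions amounts to
  minimising the divergence for almost every \<open>y\<close>.
\<close>

section \<open>The extended-real integral\<close>

lemma e2ennreal_minus_infty [simp]: "e2ennreal (- \<infinity>) = 0"
  by (rule e2ennreal_neg) simp

lemma enn2ereal_ennreal_max: "enn2ereal (ennreal r) = ereal (max 0 r)"
  by (cases "0 \<le> r") (auto simp: max_def ennreal_neg zero_ennreal.rep_eq)

text \<open>Asymmetric on purpose: the integral may be \<open>\<infinity>\<close> but not
  \<open>- \<infinity>\<close>. This is the class on which \<open>ereal_integral\<close> is
  additive; every other measurable function has integral \<open>- \<infinity>\<close>.\<close>

definition quasi_integrable :: "'a measure \<Rightarrow> ('a \<Rightarrow> ereal) \<Rightarrow> bool" where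
  "quasi_integrable M f \<longleftrightarrow>
     f \<in> borel_measurable M \<and> (\<integral>\<^sup>+x. e2ennreal (- f x) \<partial>M) < \<infinity>"

lemma ereal_integral_quasi_integrable:
  "quasi_integrable M f \<Longrightarrow> ereal_integral M f =
     enn2ereal (\<integral>\<^sup>+x. e2ennreal (f x) \<partial>M) - enn2ereal (\<integral>\<^sup>+x. e2ennreal (- f x) \<partial>M)"
  by (auto simp: quasi_integrable_def ereal_integral_def)

lemma ereal_integral_not_quasi_integrable:
  assumes "f \<in> borel_measurable M" "\<not> quasi_integrable M f"
  shows "ereal_integral M f = - \<infinity>"
  using assms by (auto simp: quasi_integrable_def ereal_integral_def less_top)

lemma quasi_integrable_AE:
  assumes "quasi_integrable M f"
  shows "AE x in M. f x \<noteq> - \<infinity>"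
proof -
  have [measurable]: "f \<in> borel_measurable M"
    using assms by (simp add: quasi_integrable_def)
  have "AE x in M. e2ennreal (- f x) \<noteq> \<infinity>"
    using assms by (intro nn_integral_noteq_infinite) (auto simp: quasi_integrable_def)
  then show ?thesis
    by eventually_elim auto
qed

lemma quasi_integrable_mono:
  assumes "quasi_integrable M f" "g \<in> borel_measurable M" "AE x in M. f x \<le> g x"
  shows "quasi_integrable M g"
proof -
  have "(\<integral>\<^sup>+x. e2ennreal (- g x) \<partial>M) \<le> (\<integral>\<^sup>+x. e2ennreal (- f x) \<partial>M)"
    using assms(3) by (intro nn_integral_mono_AE) (auto elim!: eventually_mono intro!: e2ennreal_mono)
  then show ?thesis
    using assms by (auto simp: quasi_integrable_def)
qed

text \<open>For f = p - q the identity p + f^- = q + f^+ holds wherever q is finite, hence almost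
  everywhere. It contains no subtraction, so it can be integrated first and rearranged afterwards;
  this is legitimate because f^- is bounded by q and q has a finite integral.\<close>

lemma ereal_integral_diff:
  fixes p q :: "'a \<Rightarrow> ennreal"
  assumes [measurable]: "p \<in> borel_measurable M" "q \<in> borel_measurable M"
    and q: "(\<integral>\<^sup>+x. q x \<partial>M) < \<infinity>"
  shows "quasi_integrable M (\<lambda>x. enn2ereal (p x) - enn2ereal (q x))" (is "quasi_integrable M ?f")
    and "ereal_integral M (\<lambda>x. enn2ereal (p x) - enn2ereal (q x)) =
      enn2ereal (\<integral>\<^sup>+x. p x \<partial>M) - enn2ereal (\<integral>\<^sup>+x. q x \<partial>M)"
proof -
  have le: "e2ennreal (- (enn2ereal a - enn2ereal b)) \<le> b" for a b
    by (cases a; cases b) (auto simp: intro!: ennreal_leI)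
  have d: "(\<integral>\<^sup>+x. e2ennreal (- ?f x) \<partial>M) \<le> (\<integral>\<^sup>+x. q x \<partial>M)"
    by (intro nn_integral_mono le)
  then show qi: "quasi_integrable M ?f"
    using q by (auto simp: quasi_integrable_def)
  have real: "ennreal r + ennreal (t - r) = ennreal t + ennreal (r - t)" if "0 \<le> r" "0 \<le> t" for r t
    using that by (cases "r \<le> t") (auto simp: ennreal_neg simp flip: ennreal_plus)
  have eq: "a + e2ennreal (- (enn2ereal a - enn2ereal b)) = b + e2ennreal (enn2ereal a - enn2ereal b)"
    if "b \<noteq> \<infinity>" for a b
    using that
    by (cases a; cases b) (auto simp: real)
  have "AE x in M. q x \<noteq> \<infinity>"
    using q by (intro nn_integral_noteq_infinite) auto
  then have "(\<integral>\<^sup>+x. p x + e2ennreal (- ?f x) \<partial>M) = (\<integral>\<^sup>+x. q x + e2ennreal (?f x) \<partial>M)"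
    by (intro nn_integral_cong_AE) (rule eventually_mono, assumption, rule eq)
  then have "(\<integral>\<^sup>+x. p x \<partial>M) + (\<integral>\<^sup>+x. e2ennreal (- ?f x) \<partial>M) =
      (\<integral>\<^sup>+x. q x \<partial>M) + (\<integral>\<^sup>+x. e2ennreal (?f x) \<partial>M)"
    by (simp add: nn_integral_add)
  moreover have "enn2ereal a - enn2ereal b = enn2ereal c - enn2ereal d"
    if "c + b = d + a" "d < \<infinity>" "b \<le> d" for a b c d
    using that
    by (cases a; cases b; cases c; cases d) (auto simp: top_unique simp flip: ennreal_plus)
  ultimately show "ereal_integral M ?f = enn2ereal (\<integral>\<^sup>+x. p x \<partial>M) - enn2ereal (\<integral>\<^sup>+x. q x \<partial>M)"
    unfolding ereal_integral_quasi_integrable[OF qi] using q d by blast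
qed

text \<open>Neither function is \<open>- \<infinity>\<close> on a set of positive measure, so
  \<open>f x + g x\<close> is almost everywhere the sum of the positive parts minus the sum of the
  negative parts, and \<open>ereal_integral_diff\<close> applies to this difference.\<close>

lemma ereal_integral_add:
  assumes f: "quasi_integrable M f" and g: "quasi_integrable M g"
  shows "quasi_integrable M (\<lambda>x. f x + g x)"
    and "ereal_integral M (\<lambda>x. f x + g x) = ereal_integral M f + ereal_integral M g"
proof -
  have [measurable]: "f \<in> borel_measurable M" "g \<in> borel_measurable M"
    using f g by (auto simp: quasi_integrable_def)
  let ?p = "\<lambda>x. e2ennreal (f x) + e2ennreal (g x)"
  let ?q = "\<lambda>x. e2ennreal (- f x) + e2ennreal (- g x)"
  have q: "(\<integral>\<^sup>+x. ?q x \<partial>M) < \<infinity>"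
    using f g by (simp add: nn_integral_add quasi_integrable_def)
  note D = ereal_integral_diff[of ?p M ?q, OF _ _ q]
  have eq: "enn2ereal (e2ennreal a + e2ennreal b) - enn2ereal (e2ennreal (- a) + e2ennreal (- b)) = a + b"
    if "a \<noteq> -\<infinity>" "b \<noteq> -\<infinity>" for a b
    using that by (cases a; cases b) 
      (auto simp: plus_ennreal.rep_eq enn2ereal_ennreal_max zero_ennreal.rep_eq max_def)
  have ae: "AE x in M. enn2ereal (?p x) - enn2ereal (?q x) = f x + g x"
    using quasi_integrable_AE[OF f] quasi_integrable_AE[OF g] by eventually_elim (rule eq)
  show "quasi_integrable M (\<lambda>x. f x + g x)"
    by (rule quasi_integrable_mono[OF D(1)]) (use ae in \<open>auto elim!: eventually_mono\<close>)
  have "ereal_integral M (\<lambda>x. f x + g x) = enn2ereal (\<integral>\<^sup>+x. ?p x \<partial>M) - enn2ereal (\<integral>\<^sup>+x. ?q x \<partial>M)"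
    using D(2) ereal_integral_cong_AE[OF ae] by simp
  also have "\<dots> = ereal_integral M f + ereal_integral M g"
  proof -
    have "enn2ereal (a + b) - enn2ereal (c + d) = (enn2ereal a - enn2ereal c) + (enn2ereal b - enn2ereal d)"
      if "c < \<infinity>" "d < \<infinity>" for a b c d
      using that by (cases a; cases b; cases c; cases d) (auto simp flip: ennreal_plus)
    then show ?thesis
      using f g by (simp add: nn_integral_add ereal_integral_quasi_integrable)
        (simp add: quasi_integrable_def)
  qed
  finally show "ereal_integral M (\<lambda>x. f x + g x) = ereal_integral M f + ereal_integral M g" .
qed

text \<open>Stated for arbitrary functions because it is later applied to an infimum over a possibly
  uncountable set of betting functions.\<close>

lemma ereal_integral_mono:
  assumes "AE x in M. f x \<le> g x"
  shows "ereal_integral M f \<le> ereal_integral M g"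
proof -
  have "(\<integral>\<^sup>+x. e2ennreal (f x) \<partial>M) \<le> (\<integral>\<^sup>+x. e2ennreal (g x) \<partial>M)"
    and "(\<integral>\<^sup>+x. e2ennreal (- g x) \<partial>M) \<le> (\<integral>\<^sup>+x. e2ennreal (- f x) \<partial>M)"
    using assms by (auto intro!: nn_integral_mono_AE e2ennreal_mono elim!: eventually_mono)
  then show ?thesis
    by (auto simp: ereal_integral_def top_unique intro!: ereal_minus_mono simp flip: less_eq_ennreal.rep_eq)
qed

lemma ereal_integral_nonneg:
  assumes "AE x in M. 0 \<le> f x"
  shows "ereal_integral M f = enn2ereal (\<integral>\<^sup>+x. e2ennreal (f x) \<partial>M)"
proof -
  have "(\<integral>\<^sup>+x. e2ennreal (- f x) \<partial>M) = (\<integral>\<^sup>+x. 0 \<partial>M)"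
    using assms by (intro nn_integral_cong_AE) (auto elim!: eventually_mono simp: e2ennreal_neg)
  then show ?thesis
    by (simp add: ereal_integral_def zero_ennreal.rep_eq)
qed

lemma quasi_integrable_nonneg:
  assumes "AE x in M. 0 \<le> f x" "f \<in> borel_measurable M"
  shows "quasi_integrable M f"
proof -
  have "(\<integral>\<^sup>+x. e2ennreal (- f x) \<partial>M) = (\<integral>\<^sup>+x. 0 \<partial>M)"
    using assms(1) by (intro nn_integral_cong_AE) (auto elim!: eventually_mono simp: e2ennreal_neg)
  then show ?thesis
    using assms(2) by (simp add: quasi_integrable_def)
qed

lemma enn2ereal_eq_0_iff: "enn2ereal x = 0 \<longleftrightarrow> x = 0"
  by (metis enn2ereal_inject zero_ennreal.rep_eq)

lemma ereal_integral_eq_0D: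
  assumes "AE x in M. 0 \<le> f x" "f \<in> borel_measurable M" "ereal_integral M f = 0"
  shows "AE x in M. f x = 0"
proof -
  have "(\<integral>\<^sup>+x. e2ennreal (f x) \<partial>M) = 0"
    using assms by (simp add: ereal_integral_nonneg enn2ereal_eq_0_iff)
  then have "AE x in M. e2ennreal (f x) = 0"
    using assms(2) by (subst (asm) nn_integral_0_iff_AE) auto
  with assms(1) show ?thesis
    by eventually_elim (metis enn2ereal_e2ennreal enn2ereal_eq_0_iff)
qed

text \<open>Equality case of monotonicity: the nonnegative difference \<open>g x - f x\<close> has
  integral 0 once the common finite value is cancelled.\<close>

lemma ereal_integral_eq_imp_AE_eq:
  assumes f: "quasi_integrable M f" and g: "g \<in> borel_measurable M"
    and le: "AE x in M. f x \<le> g x"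
    and eq: "ereal_integral M f = ereal_integral M g" "\<bar>ereal_integral M f\<bar> \<noteq> \<infinity>"
  shows "AE x in M. f x = g x"
proof -
  have [measurable]: "f \<in> borel_measurable M" "g \<in> borel_measurable M"
    using f g by (auto simp: quasi_integrable_def)
  have d0: "AE x in M. 0 \<le> g x - f x"
    using le by eventually_elim (rule ereal_diff_positive)
  have sum: "AE x in M. f x + (g x - f x) = g x"
    using quasi_integrable_AE[OF f] le
  proof eventually_elim
    case (elim x)
    then show ?case by (cases "f x"; cases "g x") auto
  qed
  have "ereal_integral M f + ereal_integral M (\<lambda>x. g x - f x) = ereal_integral M g"
    using ereal_integral_add(2)[OF f quasi_integrable_nonneg[OF d0]] ereal_integral_cong_AE[OF sum]
    by simp
  then have "ereal_integral M (\<lambda>x. g x - f x) = 0"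
    using eq by (cases "ereal_integral M (\<lambda>x. g x - f x)"; cases "ereal_integral M f") auto
  then have "AE x in M. g x - f x = 0"
    using d0 by (intro ereal_integral_eq_0D) auto
  with le show ?thesis
  proof eventually_elim
    case (elim x)
    then show ?case by (cases "f x"; cases "g x") auto
  qed
qed

lemma ereal_integral_distr:
  assumes "f \<in> measurable M N" "g \<in> borel_measurable N"
  shows "ereal_integral (distr M N f) g = ereal_integral M (\<lambda>x. g (f x))"
  using assms by (simp add: ereal_integral_def nn_integral_distr)

lemma e2ennreal_mult_ereal:
  "0 \<le> h \<Longrightarrow> e2ennreal (ereal h * x) = ennreal h * e2ennreal x"
  by (cases x) (auto simp: ennreal_mult' mult_le_0_iff
      ennreal_mult_top zero_le_mult_iff simp flip: zero_ereal_def)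

lemma
  assumes [measurable]: "h \<in> borel_measurable M" "f \<in> borel_measurable M"
    and h: "AE x in M. 0 \<le> h x"
  shows nn_integral_neg_density: "(\<integral>\<^sup>+x. e2ennreal (- f x) \<partial>density M (\<lambda>x. ennreal (h x))) =
     (\<integral>\<^sup>+x. e2ennreal (- (ereal (h x) * f x)) \<partial>M)"
    and ereal_integral_density: "ereal_integral (density M (\<lambda>x. ennreal (h x))) f =
     ereal_integral M (\<lambda>x. ereal (h x) * f x)"
proof -
  have "AE x in M. ennreal (h x) * e2ennreal (f x) = e2ennreal (ereal (h x) * f x)"
    using h by eventually_elim (simp add: e2ennreal_mult_ereal)
  moreover have "AE x in M. ennreal (h x) * e2ennreal (- f x) = e2ennreal (- (ereal (h x) * f x))"
    using h by eventually_elim (simp add: e2ennreal_mult_ereal flip: ereal_mult_minus_right)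
  ultimately show "ereal_integral (density M (\<lambda>x. ennreal (h x))) f =
     ereal_integral M (\<lambda>x. ereal (h x) * f x)"
    and "(\<integral>\<^sup>+x. e2ennreal (- f x) \<partial>density M (\<lambda>x. ennreal (h x))) =
     (\<integral>\<^sup>+x. e2ennreal (- (ereal (h x) * f x)) \<partial>M)"
    by (simp_all add: ereal_integral_def nn_integral_density cong: nn_integral_cong_AE)
qed

section \<open>Gibbs' inequality\<close>

lemma measurable_elog [measurable]: "elog \<beta> \<in> borel_measurable borel"
  unfolding elog_def by measurable

lemma elog_noteq_infinity [simp]: "elog \<beta> x \<noteq> \<infinity>"
  by (simp add: elog_def)

text \<open>Zero factors are included: \<open>elog\<close> is \<open>- \<infinity>\<close> there and
  never \<open>\<infinity>\<close>, so ruin in one factor is ruin of the product and no sum of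
  opposite infinities arises.\<close>

lemma elog_mult:
  assumes "1 < \<beta>" "0 \<le> x" "0 \<le> y"
  shows "elog \<beta> (x * y) = elog \<beta> x + elog \<beta> y"
  using assms by (auto simp: elog_def log_mult zero_less_mult_iff)

lemma elog_prod:
  assumes "1 < \<beta>" "\<And>i. i \<in> A \<Longrightarrow> 0 \<le> f i"
  shows "elog \<beta> (\<Prod>i\<in>A. f i) = (\<Sum>i\<in>A. elog \<beta> (f i))"
  using assms(2)
proof (induction A rule: infinite_finite_induct)
  case (insert i A)
  then show ?case
    using \<open>1 < \<beta>\<close> by (simp add: elog_mult prod_nonneg)
qed (use \<open>1 < \<beta>\<close> in \<open>simp_all add: elog_def\<close>)

abbreviation KL_integrand :: "real \<Rightarrow> real \<Rightarrow> real \<Rightarrow> ereal" where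
  "KL_integrand \<beta> c g \<equiv> ereal c * (elog \<beta> c - elog \<beta> g)"

text \<open>Pointwise form of Gibbs' inequality, from the tangent bound ln t \<le> t - 1 at t = g /
  c, with equality only at t = 1. On the boundary the conventions decide: for c = 0 the integrand is
  0, and for g = 0 < c it is \<open>\<infinity>\<close>.\<close>

lemma
  assumes "1 < \<beta>" "0 \<le> c" "0 \<le> g"
  shows KL_integrand_ge: "ereal ((c - g) / ln \<beta>) \<le> KL_integrand \<beta> c g" (is ?ge)
    and KL_integrand_eqD: "KL_integrand \<beta> c g = ereal ((c - g) / ln \<beta>) \<Longrightarrow> c = g" (is "?eq \<Longrightarrow> _")
proof -
  have "0 < ln \<beta>"
    using \<open>1 < \<beta>\<close> by simp
  have "?ge \<and> (?eq \<longrightarrow> c = g)"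
  proof (cases "c = 0 \<or> g = 0")
    case True
    then show ?thesis
    proof (cases "c = 0")
      case True
      then show ?thesis
        using \<open>0 < ln \<beta>\<close> \<open>0 \<le> g\<close> by (auto simp: elog_def simp flip: zero_ereal_def)
    next
      case False
      with True have "g = 0" "0 < c" using assms by auto
      then show ?thesis
        by (simp add: elog_def)
    qed
  next
    case False
    with assms have pos: "0 < c" "0 < g" by auto
    have eq: "KL_integrand \<beta> c g = ereal (- (c * ln (g / c)) / ln \<beta>)"
      using pos \<open>1 < \<beta>\<close> by (simp add: elog_def log_def ln_div field_simps)
    have "c * ln (g / c) \<le> c * (g / c - 1)"
      using pos by (intro mult_left_mono ln_le_minus_one) auto
    then have "c * ln (g / c) \<le> g - c"
      using pos by (simp add: right_diff_distrib)
    then have ge: ?ge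
      unfolding eq ereal_less_eq using \<open>0 < ln \<beta>\<close> by (intro divide_right_mono) auto
    have "c = g" if ?eq
    proof -
      have "c * ln (g / c) = g - c"
        using that \<open>0 < ln \<beta>\<close> unfolding eq by (simp add: field_simps)
      then have "ln (g / c) = g / c - 1"
        using pos by (simp add: field_simps)
      then have "g / c = 1"
        using pos by (intro ln_eq_minus_one) auto
      then show ?thesis
        using pos by simp
    qed
    with ge show ?thesis by blast
  qed
  then show ?ge "?eq \<Longrightarrow> c = g" by auto
qed

lemma betting_functionsD:
  assumes "g \<in> betting_functions S"
  shows "g \<in> borel_measurable S" "\<And>x. x \<in> space S \<Longrightarrow> 0 \<le> g x" "integrable S g" "(\<integral>x. g x \<partial>S) = 1"
  using assms not_integrable_integral_eq[of S g] by (auto simp: betting_functions_def)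

text \<open>Both functions have mass 1, so the pointwise lower bound (c - g) / ln \<beta> integrates
  to 0; a vanishing divergence forces equality in that bound almost everywhere. The bound on the
  negative part is uniform in \<open>c\<close> and \<open>g\<close>, which later permits integration
  over y.\<close>

lemma
  assumes "1 < \<beta>" and c: "c \<in> betting_functions S" and g: "g \<in> betting_functions S"
  shows nn_integral_neg_KL_integrand_le:
      "(\<integral>\<^sup>+x. e2ennreal (- KL_integrand \<beta> (c x) (g x)) \<partial>S) \<le> ennreal (1 / ln \<beta>)"
    and KL_div_nonneg: "0 \<le> KL_div \<beta> S c g"
    and KL_div_eq_0D: "KL_div \<beta> S c g = 0 \<Longrightarrow> AE x in S. g x = c x"
proof -
  note [measurable] = betting_functionsD(1)[OF c] betting_functionsD(1)[OF g]
  let ?\<phi> = "\<lambda>x. KL_integrand \<beta> (c x) (g x)" and ?d = "\<lambda>x. (c x - g x) / ln \<beta>"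
  have "0 < ln \<beta>"
    using \<open>1 < \<beta>\<close> by simp
  have ge: "AE x in S. ereal (?d x) \<le> ?\<phi> x"
    using betting_functionsD(2)[OF c] betting_functionsD(2)[OF g] KL_integrand_ge[OF \<open>1 < \<beta>\<close>] by auto
  have int: "integrable S ?d"
    using betting_functionsD(3)[OF c] betting_functionsD(3)[OF g] by auto
  have int0: "ereal_integral S (\<lambda>x. ereal (?d x)) = 0"
    using betting_functionsD(3,4)[OF c] betting_functionsD(3,4)[OF g]
    by (simp add: ereal_integral_eq_integral[OF int])
  \<comment> \<open>Dropping the nonnegative \<open>c x\<close> from the pointwise bound leaves at
    most \<open>g x / ln \<beta>\<close> as negative part.\<close>
  have "(\<integral>\<^sup>+x. e2ennreal (- ?\<phi> x) \<partial>S) \<le> (\<integral>\<^sup>+x. ennreal (g x / ln \<beta>) \<partial>S)"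
  proof (intro nn_integral_mono_AE)
    have "AE x in S. 0 \<le> c x"
      using betting_functionsD(2)[OF c] by auto
    with ge show "AE x in S. e2ennreal (- ?\<phi> x) \<le> ennreal (g x / ln \<beta>)"
    proof eventually_elim
      case (elim x)
      have "- ?\<phi> x \<le> ereal (- ?d x)"
        using elim(1) by (simp add: ereal_uminus_le_reorder)
      also have "\<dots> \<le> ereal (g x / ln \<beta>)"
        using elim(2) \<open>0 < ln \<beta>\<close> by (simp add: diff_divide_distrib)
      finally show ?case
        by (metis e2ennreal_mono e2ennreal_ereal)
    qed
  qed
  also have "\<dots> = ennreal (1 / ln \<beta>)"
    using betting_functionsD(2-4)[OF g] \<open>0 < ln \<beta>\<close> by (subst nn_integral_eq_integral) auto
  finally show neg: "(\<integral>\<^sup>+x. e2ennreal (- ?\<phi> x) \<partial>S) \<le> ennreal (1 / ln \<beta>)" .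
  show "0 \<le> KL_div \<beta> S c g"
    using ereal_integral_mono[OF ge] by (simp add: KL_div_def int0)
  assume "KL_div \<beta> S c g = 0"
  have "quasi_integrable S (\<lambda>x. ereal (?d x))"
    using int by (auto simp: quasi_integrable_def real_integrable_def less_top)
  then have "AE x in S. ereal (?d x) = ?\<phi> x"
    using ge int0 \<open>KL_div \<beta> S c g = 0\<close>
    by (intro ereal_integral_eq_imp_AE_eq) (auto simp: KL_div_def)
  moreover have "AE x in S. 0 \<le> c x \<and> 0 \<le> g x"
    using betting_functionsD(2)[OF c] betting_functionsD(2)[OF g] by auto
  ultimately show "AE x in S. g x = c x"
  proof eventually_elim
    case (elim x)
    then show ?case
      using KL_integrand_eqD[OF \<open>1 < \<beta>\<close>, of "c x" "g x"] elim by auto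
  qed
qed

text \<open>Fubini for an integrand of both signs: the negative parts of the sections are bounded by
  one constant \<open>K\<close> and the weight \<open>h\<close> has finite mass, so the total
  negative part is finite. Tonelli treats the two parts separately, and
  \<open>ereal_integral_diff\<close> reassembles them.\<close>

lemma (in pair_sigma_finite)
  fixes \<phi> :: "'a \<times> 'b \<Rightarrow> ereal"
  assumes [measurable]: "\<phi> \<in> borel_measurable (M1 \<Otimes>\<^sub>M M2)" "h \<in> borel_measurable M2"
    and h: "\<And>y. y \<in> space M2 \<Longrightarrow> 0 \<le> h y" "(\<integral>\<^sup>+y. ennreal (h y) \<partial>M2) < \<infinity>"
    and K: "K < \<infinity>" "\<And>y. y \<in> space M2 \<Longrightarrow> (\<integral>\<^sup>+x. e2ennreal (- \<phi> (x, y)) \<partial>M1) \<le> K"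
  shows quasi_integrable_weighted_pair: "quasi_integrable (M1 \<Otimes>\<^sub>M M2) (\<lambda>z. ereal (h (snd z)) * \<phi> z)"
    and ereal_integral_weighted_pair: "ereal_integral (M1 \<Otimes>\<^sub>M M2) (\<lambda>z. ereal (h (snd z)) * \<phi> z) =
      ereal_integral M2 (\<lambda>y. ereal (h y) * ereal_integral M1 (\<lambda>x. \<phi> (x, y)))"
proof -
  let ?f = "\<lambda>z. ereal (h (snd z)) * \<phi> z"
  define p where "p y = (\<integral>\<^sup>+x. e2ennreal (\<phi> (x, y)) \<partial>M1)" for y
  define q where "q y = (\<integral>\<^sup>+x. e2ennreal (- \<phi> (x, y)) \<partial>M1)" for y
  have [measurable]: "p \<in> borel_measurable M2" "q \<in> borel_measurable M2"
    unfolding p_def q_def by measurable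
  have pos: "(\<integral>\<^sup>+z. e2ennreal (?f z) \<partial>(M1 \<Otimes>\<^sub>M M2)) = (\<integral>\<^sup>+y. ennreal (h y) * p y \<partial>M2)"
    unfolding p_def
    by (subst nn_integral_snd[symmetric], measurable)
       (auto intro!: nn_integral_cong simp: e2ennreal_mult_ereal h nn_integral_cmult)
  have neg: "(\<integral>\<^sup>+z. e2ennreal (- ?f z) \<partial>(M1 \<Otimes>\<^sub>M M2)) = (\<integral>\<^sup>+y. ennreal (h y) * q y \<partial>M2)"
    unfolding q_def
    by (subst nn_integral_snd[symmetric], measurable)
       (auto intro!: nn_integral_cong simp: e2ennreal_mult_ereal h nn_integral_cmult
         simp flip: ereal_mult_minus_right)
  have "(\<integral>\<^sup>+y. ennreal (h y) * q y \<partial>M2) \<le> (\<integral>\<^sup>+y. ennreal (h y) * K \<partial>M2)"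
    using K by (intro nn_integral_mono mult_left_mono) (auto simp: q_def)
  also have "\<dots> < \<infinity>"
    using h(2) K(1) by (simp add: nn_integral_multc ennreal_mult_less_top)
  finally have fin: "(\<integral>\<^sup>+y. ennreal (h y) * q y \<partial>M2) < \<infinity>" .
  then show qi: "quasi_integrable (M1 \<Otimes>\<^sub>M M2) ?f"
    by (simp add: quasi_integrable_def neg)
  have "ereal_integral M2 (\<lambda>y. ereal (h y) * ereal_integral M1 (\<lambda>x. \<phi> (x, y))) =
      ereal_integral M2 (\<lambda>y. enn2ereal (ennreal (h y) * p y) - enn2ereal (ennreal (h y) * q y))"
  proof (rule ereal_integral_cong_AE, rule AE_I2)
    fix y assume y: "y \<in> space M2"
    then have "q y < \<infinity>"
      using K by (auto simp: q_def intro: le_less_trans)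
    then have "ereal_integral M1 (\<lambda>x. \<phi> (x, y)) = enn2ereal (p y) - enn2ereal (q y)"
      using y by (auto simp: ereal_integral_def p_def q_def)
    \<comment> \<open>Distributivity relies on the finite subtrahend; at r = 0 the convention 0 *
      \<infinity> = 0 makes both sides vanish.\<close>
    moreover have "ereal r * (enn2ereal a - enn2ereal b) = enn2ereal (ennreal r * a) - enn2ereal (ennreal r * b)"
      if "0 \<le> r" "b < \<infinity>" for r a b
      using that by (cases a; cases b; cases "r = 0")
        (auto simp: ennreal_mult_top zero_ennreal.rep_eq right_diff_distrib simp flip: ennreal_mult zero_ereal_def)
    ultimately show "ereal (h y) * ereal_integral M1 (\<lambda>x. \<phi> (x, y)) =
        enn2ereal (ennreal (h y) * p y) - enn2ereal (ennreal (h y) * q y)"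
      using h(1)[OF y] \<open>q y < \<infinity>\<close> by simp
  qed
  also have "\<dots> = ereal_integral (M1 \<Otimes>\<^sub>M M2) ?f"
    using ereal_integral_diff(2)[of "\<lambda>y. ennreal (h y) * p y" M2 "\<lambda>y. ennreal (h y) * q y"] fin
    by (simp add: ereal_integral_quasi_integrable[OF qi] pos neg)
  finally show "ereal_integral (M1 \<Otimes>\<^sub>M M2) ?f =
      ereal_integral M2 (\<lambda>y. ereal (h y) * ereal_integral M1 (\<lambda>x. \<phi> (x, y)))" ..
qed

section \<open>Sums of i.i.d. random variables\<close>

text \<open>The quasi-integrable half of the i.i.d. statement, resting on additivity and the common
  law; independence enters when the negative part is infinite.\<close>

lemma (in prob_space) quasi_integrable_sum_iid:
  assumes "finite J" and rv: "\<And>i. i \<in> J \<Longrightarrow> Z i \<in> measurable M N"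
    and P: "\<And>i. i \<in> J \<Longrightarrow> distr M N (Z i) = P" and g: "quasi_integrable P g" "g \<in> borel_measurable N"
  shows "quasi_integrable M (\<lambda>w. \<Sum>i\<in>J. g (Z i w)) \<and>
    ereal_integral M (\<lambda>w. \<Sum>i\<in>J. g (Z i w)) = ereal (real (card J)) * ereal_integral P g"
  using assms(1-3)
proof (induction J)
  case empty
  show ?case
    by (simp add: quasi_integrable_def ereal_integral_def zero_ennreal.rep_eq flip: zero_ereal_def)
next
  case (insert i J)
  then have IH: "quasi_integrable M (\<lambda>w. \<Sum>i\<in>J. g (Z i w))"
    "ereal_integral M (\<lambda>w. \<Sum>i\<in>J. g (Z i w)) = ereal (real (card J)) * ereal_integral P g"
    by auto
  have Zi: "Z i \<in> measurable M N" "distr M N (Z i) = P"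
    using insert.prems by auto
  have 1: "quasi_integrable M (\<lambda>w. g (Z i w))"
    using g Zi(1) unfolding Zi(2)[symmetric]
    by (auto simp: quasi_integrable_def nn_integral_distr)
  have 2: "ereal_integral M (\<lambda>w. g (Z i w)) = ereal_integral P g"
    using ereal_integral_distr[OF Zi(1) g(2)] Zi(2) by simp
  show ?case
  proof -
    have "ereal (real (Suc k)) * x = x + ereal (real k) * x" for k x
      using ereal_left_distrib[of 1 "ereal (real k)" x] by (simp add: one_ereal_def)
    then show ?thesis
      using ereal_integral_add[OF 1 IH(1)] IH(2) insert.hyps by (simp add: 2 del: of_nat_Suc)
  qed
qed

text \<open>The delicate case is an infinite negative part in a single round, which large gains of
  the other rounds might offset pointwise. A product of functions of independent rounds bounds the
  negative part of the sum from below, and its integral factorizes.\<close>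

lemma (in prob_space) ereal_integral_sum_iid:
  assumes "finite J" "J \<noteq> {}" and indep: "indep_vars (\<lambda>_. N) Z J"
    and P: "\<And>i. i \<in> J \<Longrightarrow> distr M N (Z i) = P"
    and g: "g \<in> borel_measurable N" "\<And>z. z \<in> space N \<Longrightarrow> g z \<noteq> \<infinity>"
  shows "ereal_integral M (\<lambda>w. \<Sum>i\<in>J. g (Z i w)) = ereal (real (card J)) * ereal_integral P g"
proof (cases "quasi_integrable P g")
  case True
  then show ?thesis
    using quasi_integrable_sum_iid[of J Z N P g] assms by (auto simp: indep_vars_def)
next
  case False
  have rv: "Z i \<in> measurable M N" if "i \<in> J" for i
    using indep that by (auto simp: indep_vars_def)
  obtain i0 where i0: "i0 \<in> J"
    using \<open>J \<noteq> {}\<close> by auto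
  have sP: "sets P = sets N"
    unfolding P[OF i0, symmetric] by simp
  note spP = sets_eq_imp_space_eq[OF sP]
  have [measurable]: "g \<in> borel_measurable P" and [measurable]: "g \<in> borel_measurable N"
    using g(1) measurable_cong_sets[OF sP refl] by auto
  interpret P: prob_space P
    unfolding P[OF i0, symmetric] by (rule prob_space_distr[OF rv[OF i0]])
  have negP: "(\<integral>\<^sup>+z. e2ennreal (- g z) \<partial>P) = \<infinity>"
    using False by (auto simp: quasi_integrable_def simp flip: less_top)
  txt \<open>With positive probability all rounds but \<open>i0\<close> contribute at most \<open>k\<close> each. By independence
    the negative part of round \<open>i0\<close> still has infinite integral over that event.\<close>
  obtain k :: nat where k: "emeasure P {z \<in> space P. g z \<le> ereal k} \<noteq> 0"
  proof (rule ccontr)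
    assume "\<not> thesis"
    with that have "emeasure P {z \<in> space P. g z \<le> ereal (real k)} = 0" for k :: nat
      by blast
    then have "emeasure P (\<Union>k::nat. {z \<in> space P. g z \<le> ereal (real k)}) = 0"
      by (intro emeasure_UN_eq_0) auto
    moreover have "(\<Union>k::nat. {z \<in> space P. g z \<le> ereal (real k)}) = space P"
    proof -
      have "\<exists>k::nat. g z \<le> ereal (real k)" if "z \<in> space P" for z
        using g(2)[of z] that spP real_arch_simple by (cases "g z") auto
      then show ?thesis by auto
    qed
    ultimately show False
      using P.emeasure_space_1 by simp
  qed
  \<comment> \<open>\<open>L\<close> bounds the total of the other rounds when each gains at most
    \<open>k\<close>; counting all of \<open>J\<close> is a harmless overestimate. The product of
    the \<open>u i\<close> is then the negative part of round \<open>i0\<close> shifted by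
    \<open>L\<close>, restricted to that event.\<close>
  define L where "L = real (card J) * real k"
  define u where "u i z = (if i = i0 then e2ennreal (- (g z + ereal L))
    else indicator {z \<in> space P. g z \<le> ereal (real k)} z)" for i z
  have [measurable]: "u i \<in> borel_measurable N" for i
    unfolding u_def spP by (cases "i = i0") simp_all
  have [measurable]: "u i \<in> borel_measurable P" for i
    by (simp add: measurable_cong_sets[OF sP refl])
  have top: "(\<integral>\<^sup>+z. u i0 z \<partial>P) = \<infinity>"
  proof -
    \<comment> \<open>Raising a value by \<open>L\<close> removes at most \<open>L\<close> from its
      negative part, and the constant \<open>L\<close> has a finite integral under a probability
      measure.\<close>
    have "e2ennreal (- x) \<le> e2ennreal (- (x + ereal L)) + ennreal L" for x
      by (cases x) (auto simp: L_def ennreal_plus_if intro!: ennreal_leI)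
    then have "(\<integral>\<^sup>+z. e2ennreal (- g z) \<partial>P) \<le> (\<integral>\<^sup>+z. u i0 z + ennreal L \<partial>P)"
      by (auto simp: u_def intro!: nn_integral_mono)
    also have "\<dots> = (\<integral>\<^sup>+z. u i0 z \<partial>P) + ennreal L"
      by (simp add: nn_integral_add P.emeasure_space_1)
    finally show ?thesis
      using negP by (auto simp: top_unique)
  qed
  have nz: "(\<integral>\<^sup>+z. u i z \<partial>P) \<noteq> 0" if "i \<noteq> i0" for i
    using that k by (simp add: u_def nn_integral_indicator)
  have "(\<integral>\<^sup>+w. (\<Prod>i\<in>J. u i (Z i w)) \<partial>M) = (\<Prod>i\<in>J. \<integral>\<^sup>+w. u i (Z i w) \<partial>M)"
    using \<open>finite J\<close> by (intro indep_vars_nn_integral indep_vars_compose2[OF indep]) auto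
  also have "\<dots> = (\<Prod>i\<in>J. \<integral>\<^sup>+z. u i z \<partial>P)"
    by (intro prod.cong refl) (auto simp: nn_integral_distr rv simp flip: P)
  \<comment> \<open>Because \<infinity> * 0 = 0, this product is infinite only since every other
    factor is nonzero.\<close>
  also have "\<dots> = \<infinity> * (\<Prod>i\<in>J - {i0}. \<integral>\<^sup>+z. u i z \<partial>P)"
    using \<open>finite J\<close> i0 by (simp add: prod.remove top)
  also have "\<dots> = \<infinity>"
    using \<open>finite J\<close> nz by (auto simp: ennreal_top_mult)
  finally have "(\<integral>\<^sup>+w. (\<Prod>i\<in>J. u i (Z i w)) \<partial>M) = \<infinity>" .
  moreover have "(\<integral>\<^sup>+w. (\<Prod>i\<in>J. u i (Z i w)) \<partial>M) \<le> (\<integral>\<^sup>+w. e2ennreal (- (\<Sum>i\<in>J. g (Z i w))) \<partial>M)"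
  proof (intro nn_integral_mono)
    fix w assume "w \<in> space M"
    show "(\<Prod>i\<in>J. u i (Z i w)) \<le> e2ennreal (- (\<Sum>i\<in>J. g (Z i w)))"
    \<comment> \<open>Off the event that all other rounds gain at most \<open>k\<close>, some
      indicator vanishes and the product is 0.\<close>
    proof (cases "\<forall>i\<in>J - {i0}. Z i w \<in> space P \<and> g (Z i w) \<le> ereal (real k)")
      case True
      then have "(\<Prod>i\<in>J. u i (Z i w)) = u i0 (Z i0 w)"
        using \<open>finite J\<close> i0 by (simp add: prod.remove u_def)
      moreover have "(\<Sum>i\<in>J. g (Z i w)) \<le> g (Z i0 w) + ereal L"
      proof -
        have "(\<Sum>i\<in>J - {i0}. g (Z i w)) \<le> (\<Sum>i\<in>J - {i0}. ereal (real k))"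
          using True by (intro sum_mono) auto
        also have "\<dots> = ereal (real (card (J - {i0})) * real k)"
          by simp
        also have "\<dots> \<le> ereal L"
          using \<open>finite J\<close> by (auto simp: L_def intro!: mult_right_mono card_mono)
        finally show ?thesis
          using \<open>finite J\<close> i0 by (simp add: sum.remove add_left_mono)
      qed
      ultimately show ?thesis
        by (simp add: u_def e2ennreal_mono)
    next
      case False
      then obtain i where "i \<in> J" "i \<noteq> i0" "\<not> (Z i w \<in> space P \<and> g (Z i w) \<le> ereal (real k))"
        by blast
      then have "\<exists>i\<in>J. u i (Z i w) = 0"
        by (intro bexI[of _ i]) (simp_all add: u_def)
      then have "(\<Prod>i\<in>J. u i (Z i w)) = 0"
        using \<open>finite J\<close> by (intro prod_zero)
      then show ?thesis by (simp only: zero_le)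
    qed
  qed
  ultimately have "ereal_integral M (\<lambda>w. \<Sum>i\<in>J. g (Z i w)) = - \<infinity>"
    by (simp add: ereal_integral_def top_unique)
  moreover have "ereal_integral P g = - \<infinity>"
    using negP by (simp add: ereal_integral_def)
  ultimately show ?thesis
    using \<open>finite J\<close> \<open>J \<noteq> {}\<close> by (simp add: card_gt_0_iff)
qed

section \<open>Gambling with side information\<close>

lemma (in sigma_finite_measure) measurable_ereal_integral:
  assumes [measurable]: "(\<lambda>(y, x). f y x) \<in> borel_measurable (N \<Otimes>\<^sub>M M)"
  shows "(\<lambda>y. ereal_integral M (f y)) \<in> borel_measurable N"
  unfolding ereal_integral_def by measurable

lemma nn_integral_pdf:
  assumes "prob_space M" "pdf M S X f"
  shows "(\<integral>\<^sup>+x. ennreal (f x) \<partial>S) = 1"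
proof -
  have d: "distributed M S X (\<lambda>x. ennreal (f x))"
    using assms(2) by (simp add: pdf_def)
  interpret D: prob_space "distr M S X"
    using assms(1) d by (intro prob_space.prob_space_distr) (auto simp: distributed_def)
  have "emeasure (density S (\<lambda>x. ennreal (f x))) (space S) = 1"
    using D.emeasure_space_1 by (simp add: distributed_distr_eq_density[OF d, symmetric])
  then show ?thesis
    using d by (simp add: emeasure_density distributed_def cong: nn_integral_cong)
qed

lemma pdf_measurable:
  assumes "pdf M S X f"
  shows "f \<in> borel_measurable S"
  using assms distributed_real_measurable[of S f M X] by (auto simp: pdf_def)

lemma pdf_in_betting_functions:
  assumes "prob_space M" "pdf M S X f"
  shows "f \<in> betting_functions S"
  using nn_integral_pdf[OF assms] pdf_measurable[OF assms(2)] assms(2)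
  by (auto simp: betting_functions_def pdf_def integral_eq_nn_integral)

lemma strategies_inD:
  assumes "b \<in> strategies_in S T B"
  shows "(\<lambda>z. b (snd z) (fst z)) \<in> borel_measurable (S \<Otimes>\<^sub>M T)" "\<And>y. y \<in> space T \<Longrightarrow> b y \<in> B"
  using assms by (auto simp: strategies_in_def case_prod_beta)

section \<open>A single betting round over general reference measures\<close>

locale side_information = prob_space M + S: sigma_finite_measure S + T: sigma_finite_measure T
  for M :: "'w measure" and S :: "'a measure" and T :: "'b measure" +
  fixes X :: "'w \<Rightarrow> 'a" and Y :: "'w \<Rightarrow> 'b"
    and fX :: "'a \<Rightarrow> real" and fY :: "'b \<Rightarrow> real" and fXY :: "'b \<Rightarrow> 'a \<Rightarrow> real" and \<beta> :: real
  assumes base: "1 < \<beta>"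
    and pdf_X: "pdf M S X fX" and pdf_Y: "pdf M T Y fY" and pdf_XY: "conditional_pdf M S T X Y fY fXY"
begin

sublocale ST: pair_sigma_finite S T ..

abbreviation joint_law :: "('a \<times> 'b) measure" where
  "joint_law \<equiv> distr M (S \<Otimes>\<^sub>M T) (\<lambda>w. (X w, Y w))"

definition round_gain :: "('a \<Rightarrow> real) \<Rightarrow> ('b \<Rightarrow> 'a \<Rightarrow> real) \<Rightarrow> 'a \<times> 'b \<Rightarrow> ereal" where
  "round_gain odds b z = elog \<beta> (b (snd z) (fst z) * odds (fst z))"

definition expected_gain :: "('a \<Rightarrow> real) \<Rightarrow> ('b \<Rightarrow> 'a \<Rightarrow> real) \<Rightarrow> ereal" where
  "expected_gain odds b = ereal_integral joint_law (round_gain odds b)"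

text \<open>The value is \<open>\<infinity>\<close> where \<open>b\<close> vanishes and
  \<open>fXY\<close> does not. Under \<open>joint_law\<close> the density \<open>fXY\<close> is
  almost surely positive, so the difference of two infinite logarithms does not matter.\<close>

definition log_ratio :: "('b \<Rightarrow> 'a \<Rightarrow> real) \<Rightarrow> 'a \<times> 'b \<Rightarrow> ereal" where
  "log_ratio b z = elog \<beta> (fXY (snd z) (fst z)) - elog \<beta> (b (snd z) (fst z))"

text \<open>The conditional relative entropy of \<open>fXY\<close> with respect to \<open>b\<close>
  given Y: the growth forgone by betting \<open>b\<close> in place of \<open>fXY\<close>.\<close>

definition conditional_KL :: "('b \<Rightarrow> 'a \<Rightarrow> real) \<Rightarrow> ereal" where
  "conditional_KL b = ereal_integral T (\<lambda>y. ereal (fY y) * KL_div \<beta> S (fXY y) (b y))"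

lemma measurable_fX [measurable]: "fX \<in> borel_measurable S"
  and measurable_fY [measurable]: "fY \<in> borel_measurable T"
  using pdf_measurable pdf_X pdf_Y by auto

lemma fX_nonneg: "x \<in> space S \<Longrightarrow> 0 \<le> fX x" and fY_nonneg: "y \<in> space T \<Longrightarrow> 0 \<le> fY y"
  using pdf_X pdf_Y by (auto simp: pdf_def)

lemma conditional_pdf_in_strategies: "fXY \<in> strategies S T"
proof -
  have m: "(\<lambda>(x, y). fXY y x) \<in> borel_measurable (S \<Otimes>\<^sub>M T)"
    using pdf_XY by (simp add: conditional_pdf_def)
  have "fXY y \<in> betting_functions S" if y: "y \<in> space T" for y
  proof -
    have "fXY y \<in> borel_measurable S"
      using measurable_compose[OF measurable_Pair2'[OF y] m] by simp
    moreover have "(\<forall>x\<in>space S. 0 \<le> fXY y x) \<and> (\<integral>x. fXY y x \<partial>S) = 1"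
      using pdf_XY y by (simp add: conditional_pdf_def)
    ultimately show ?thesis
      by (simp add: betting_functions_def)
  qed
  with m show ?thesis
    by (simp add: strategies_in_def)
qed

lemma marginal_in_strategies: "(\<lambda>_. fX) \<in> strategies S T"
  using pdf_in_betting_functions[OF prob_space_axioms pdf_X]
  by (auto simp: strategies_in_def case_prod_beta)

lemma strategies_nonneg: "b \<in> strategies S T \<Longrightarrow> x \<in> space S \<Longrightarrow> y \<in> space T \<Longrightarrow> 0 \<le> b y x"
  by (rule betting_functionsD(2)[OF strategies_inD(2)])

lemmas measurable_fXY [measurable] = strategies_inD(1)[OF conditional_pdf_in_strategies]

lemma measurable_XY: "(\<lambda>w. (X w, Y w)) \<in> measurable M (S \<Otimes>\<^sub>M T)"
  using pdf_XY by (auto simp: conditional_pdf_def pdf_def distributed_def)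

lemma joint_law_eq_density:
  "joint_law = density (S \<Otimes>\<^sub>M T) (\<lambda>z. ennreal (fXY (snd z) (fst z) * fY (snd z)))"
  using pdf_XY by (auto simp: conditional_pdf_def pdf_def case_prod_beta intro!: distributed_distr_eq_density)

section \<open>Almost sure statements under the laws of (X, Y) and Y\<close>

lemma AE_joint_law:
  "(AE z in joint_law. Q z) \<longleftrightarrow>
    (AE z in S \<Otimes>\<^sub>M T. 0 < fXY (snd z) (fst z) \<and> 0 < fY (snd z) \<longrightarrow> Q z)"
proof -
  have "(AE z in joint_law. Q z) \<longleftrightarrow>
    (AE z in S \<Otimes>\<^sub>M T. 0 < fXY (snd z) (fst z) * fY (snd z) \<longrightarrow> Q z)"
    unfolding joint_law_eq_density by (subst AE_density) auto
  also have "\<dots> \<longleftrightarrow> (AE z in S \<Otimes>\<^sub>M T. 0 < fXY (snd z) (fst z) \<and> 0 < fY (snd z) \<longrightarrow> Q z)"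
    by (intro AE_cong) (auto simp: zero_less_mult_iff space_pair_measure dest: fY_nonneg)
  finally show ?thesis .
qed

lemma AE_Y: "(AE y in distr M T Y. Q y) \<longleftrightarrow> (AE y in T. 0 < fY y \<longrightarrow> Q y)"
proof -
  have "distr M T Y = density T (\<lambda>y. ennreal (fY y))"
    using pdf_Y by (auto simp: pdf_def intro!: distributed_distr_eq_density)
  then show ?thesis
    by (simp only:) (subst AE_density; simp)
qed

text \<open>A joint density vanishes almost everywhere where a marginal density does. Hence the fair
  odds \<open>1 / fX x\<close> almost surely avoid the default value 1 / 0 = 0.\<close>

lemma AE_fX_pos: "AE z in joint_law. 0 < fX (fst z)"
proof -
  have "AE z in S \<Otimes>\<^sub>M T. fX (fst z) = 0 \<longrightarrow> fXY (snd z) (fst z) * fY (snd z) = 0"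
    using pdf_X pdf_XY
    by (intro subdensity_real[OF measurable_fst, of M S T "\<lambda>w. (X w, Y w)" _ X])
       (auto simp: pdf_def conditional_pdf_def case_prod_beta comp_def space_pair_measure fX_nonneg
         strategies_nonneg[OF conditional_pdf_in_strategies] fY_nonneg)
  then show ?thesis
    unfolding AE_joint_law
    using AE_space by eventually_elim (use fX_nonneg in \<open>force simp: space_pair_measure\<close>)
qed

lemma AE_joint_law_pos:
  "AE z in joint_law. z \<in> space S \<times> space T \<and> 0 < fXY (snd z) (fst z) \<and> 0 < fX (fst z)"
proof -
  have "AE z in joint_law. 0 < fXY (snd z) (fst z)"
    unfolding AE_joint_law by auto
  moreover have "AE z in joint_law. z \<in> space S \<times> space T"
    using AE_space[of joint_law] by (simp add: space_pair_measure)
  ultimately show ?thesis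
    using AE_fX_pos by eventually_elim blast
qed

lemma measurable_log_ratio:
  assumes "b \<in> strategies S T"
  shows "log_ratio b \<in> borel_measurable (S \<Otimes>\<^sub>M T)"
  unfolding log_ratio_def using strategies_inD(1)[OF assms] by measurable

lemma measurable_round_gain:
  assumes "b \<in> strategies S T" "odds \<in> borel_measurable S"
  shows "round_gain odds b \<in> borel_measurable (S \<Otimes>\<^sub>M T)"
  unfolding round_gain_def using strategies_inD(1)[OF assms(1)] assms(2) by measurable

lemma measurable_KL_div:
  assumes "b \<in> strategies S T"
  shows "(\<lambda>y. KL_div \<beta> S (fXY y) (b y)) \<in> borel_measurable T"
proof -
  note [measurable] = strategies_inD(1)[OF assms]
  have "(\<lambda>z. KL_integrand \<beta> (fXY (snd (snd z, fst z)) (fst (snd z, fst z)))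
      (b (snd (snd z, fst z)) (fst (snd z, fst z)))) \<in> borel_measurable (T \<Otimes>\<^sub>M S)"
    by measurable
  then show ?thesis
    unfolding KL_div_def by (intro S.measurable_ereal_integral) (simp add: case_prod_beta)
qed

lemma conditional_KL_integrand_nonneg:
  assumes "b \<in> strategies S T" "y \<in> space T"
  shows "0 \<le> ereal (fY y) * KL_div \<beta> S (fXY y) (b y)"
  using fY_nonneg[OF assms(2)]
    KL_div_nonneg[OF base strategies_inD(2)[OF conditional_pdf_in_strategies assms(2)] strategies_inD(2)[OF assms]]
  by (intro ereal_0_le_mult) auto

lemma conditional_KL_nonneg: "b \<in> strategies S T \<Longrightarrow> 0 \<le> conditional_KL b"
  unfolding conditional_KL_def
  by (subst ereal_integral_nonneg) (auto intro: conditional_KL_integrand_nonneg)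

text \<open>Chain rule for the divergence. In the joint density, the factor \<open>fXY\<close> turns
  the log ratio into the divergence integrand, while \<open>fY\<close> becomes the weight in the
  Fubini lemma. Gibbs' inequality supplies the uniform bound 1 / ln \<beta> on the sections.\<close>

lemma
  assumes b: "b \<in> strategies S T"
  shows quasi_integrable_log_ratio: "quasi_integrable joint_law (log_ratio b)"
    and ereal_integral_log_ratio: "ereal_integral joint_law (log_ratio b) = conditional_KL b"
proof -
  note [measurable] = strategies_inD(1)[OF b] measurable_log_ratio[OF b]
  let ?\<phi> = "\<lambda>z. KL_integrand \<beta> (fXY (snd z) (fst z)) (b (snd z) (fst z))"
  let ?h = "\<lambda>z. fXY (snd z) (fst z) * fY (snd z)"
  have h: "AE z in S \<Otimes>\<^sub>M T. 0 \<le> ?h z"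
    by (auto simp: space_pair_measure strategies_nonneg[OF conditional_pdf_in_strategies] fY_nonneg)
  have eq: "ereal (?h z) * log_ratio b z = ereal (fY (snd z)) * ?\<phi> z" for z
    by (simp add: log_ratio_def mult.assoc mult.left_commute flip: times_ereal.simps(1))
  have \<phi>: "?\<phi> \<in> borel_measurable (S \<Otimes>\<^sub>M T)"
    by measurable
  have fin: "(\<integral>\<^sup>+y. ennreal (fY y) \<partial>T) < \<infinity>"
    using nn_integral_pdf[OF prob_space_axioms pdf_Y] by simp
  have neg: "(\<integral>\<^sup>+x. e2ennreal (- ?\<phi> (x, y)) \<partial>S) \<le> ennreal (1 / ln \<beta>)" if "y \<in> space T" for y
    using nn_integral_neg_KL_integrand_le[OF base, of "fXY y" S "b y"]
      strategies_inD(2)[OF b that] strategies_inD(2)[OF conditional_pdf_in_strategies that] by simp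
  note * = \<phi> measurable_fY fY_nonneg fin _ neg
  show "quasi_integrable joint_law (log_ratio b)"
    using ST.quasi_integrable_weighted_pair[OF *]
    by (simp add: quasi_integrable_def nn_integral_neg_density[OF _ _ h] joint_law_eq_density eq)
  show "ereal_integral joint_law (log_ratio b) = conditional_KL b"
    using ST.ereal_integral_weighted_pair[OF *]
    by (simp add: conditional_KL_def KL_div_def ereal_integral_density[OF _ _ h] joint_law_eq_density eq)
qed

lemma round_gain_neq_infty: "round_gain odds b z \<noteq> \<infinity>"
  by (simp add: round_gain_def)

text \<open>Integrates log (fXY o) = log (b o) + log (fXY / b). It is stated as a sum, which stays
  meaningful when the divergence is infinite.\<close>

lemma expected_gain_conditional_pdf:
  assumes b: "b \<in> strategies S T"
    and odds: "odds \<in> borel_measurable S" "\<forall>x\<in>space S. 0 \<le> odds x"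
    and qi: "quasi_integrable joint_law (round_gain odds b)"
  shows "expected_gain odds fXY = expected_gain odds b + conditional_KL b"
proof -
  have "AE z in joint_law. round_gain odds fXY z = round_gain odds b z + log_ratio b z"
    using AE_joint_law_pos quasi_integrable_AE[OF qi]
  proof eventually_elim
    case (elim z)
    \<comment> \<open>Quasi-integrability excludes ruin almost surely, so the bet and the odds are
      both positive.\<close>
    then have "0 < b (snd z) (fst z)" "0 < odds (fst z)"
      using strategies_nonneg[OF b] odds(2)
      by (auto simp: round_gain_def elog_def zero_less_mult_iff less_le split: if_splits)
    then show ?case
      using elim base by (simp add: round_gain_def log_ratio_def elog_def log_mult)
  qed
  then show ?thesis
    unfolding expected_gain_def ereal_integral_log_ratio[OF b, symmetric]
      ereal_integral_add(2)[OF qi quasi_integrable_log_ratio[OF b], symmetric]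
    by (rule ereal_integral_cong_AE)
qed

lemma expected_gain_neq_minus_infty:
  assumes "quasi_integrable joint_law (round_gain odds b)"
  shows "expected_gain odds b \<noteq> - \<infinity>"
proof -
  have "enn2ereal x - enn2ereal y \<noteq> - \<infinity>" if "y < \<infinity>" for x y
    using that by (cases x; cases y) auto
  then show ?thesis
    using assms unfolding expected_gain_def ereal_integral_quasi_integrable[OF assms]
    by (simp add: quasi_integrable_def)
qed

lemma expected_gain_eq_minus_infty:
  assumes "b \<in> strategies S T" "odds \<in> borel_measurable S"
    and "\<not> quasi_integrable joint_law (round_gain odds b)"
  shows "expected_gain odds b = - \<infinity>"
  unfolding expected_gain_def using assms(3) measurable_round_gain[OF assms(1,2)]
  by (intro ereal_integral_not_quasi_integrable) auto

lemma expected_gain_le: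
  assumes "b \<in> strategies S T" "odds \<in> borel_measurable S" "\<forall>x\<in>space S. 0 \<le> odds x"
  shows "expected_gain odds b \<le> expected_gain odds fXY"
proof (cases "quasi_integrable joint_law (round_gain odds b)")
  case True
  show ?thesis
    unfolding expected_gain_conditional_pdf[OF assms True]
    using add_left_mono[OF conditional_KL_nonneg[OF assms(1)], of "expected_gain odds b"]
    by (simp only: add_0_right)
next
  case False
  then show ?thesis
    using expected_gain_eq_minus_infty[OF assms(1,2)] by simp
qed

text \<open>Cancelling the finite gain leaves a conditional divergence of 0. Its integrand is
  nonnegative, so for almost every y with \<open>0 < fY y\<close> the divergence itself is 0, and
  the equality case of Gibbs' inequality applies.\<close>

lemma expected_gain_eqD:
  assumes "b \<in> strategies S T" "odds \<in> borel_measurable S" "\<forall>x\<in>space S. 0 \<le> odds x"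
    and eq: "expected_gain odds b = expected_gain odds fXY" and fin: "\<bar>expected_gain odds fXY\<bar> \<noteq> \<infinity>"
  shows "AE y in distr M T Y. AE x in S. b y x = fXY y x"
proof (cases "quasi_integrable joint_law (round_gain odds b)")
  case True
  have "conditional_KL b = 0"
    using expected_gain_conditional_pdf[OF assms(1-3) True] fin unfolding eq[symmetric]
    by (cases "conditional_KL b"; cases "expected_gain odds b") auto
  then have "AE y in T. ereal (fY y) * KL_div \<beta> S (fXY y) (b y) = 0"
    unfolding conditional_KL_def
    using conditional_KL_integrand_nonneg[OF assms(1)] measurable_KL_div[OF assms(1)]
    by (intro ereal_integral_eq_0D) auto
  then show ?thesis
    unfolding AE_Y using AE_space
  proof eventually_elim
    case (elim y)
    then show ?case
      using KL_div_eq_0D[OF base strategies_inD(2)[OF conditional_pdf_in_strategies elim(2)] strategies_inD(2)[OF assms(1) elim(2)]]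
      by (auto simp flip: zero_ereal_def)
  qed
next
  case False
  then have "expected_gain odds fXY = - \<infinity>"
    using expected_gain_eq_minus_infty[OF assms(1,2)] eq by simp
  with fin show ?thesis by simp
qed

section \<open>Fair odds and mutual information\<close>

context
  fixes odds
  assumes fair: "\<forall>x\<in>space S. odds x = 1 / fX x"
begin

lemma fair_nonneg: "\<forall>x\<in>space S. 0 \<le> odds x"
  by (simp add: fair fX_nonneg)

lemma measurable_fair: "odds \<in> borel_measurable S"
  using fair by (subst measurable_cong) auto

lemma expected_gain_fair: "expected_gain odds fXY = mutual_info \<beta> M X Y fX fXY"
proof -
  have "expected_gain odds fXY = ereal_integral M (\<lambda>w. round_gain odds fXY (X w, Y w))"
    unfolding expected_gain_def
    by (rule ereal_integral_distr[OF measurable_XY measurable_round_gain[OF conditional_pdf_in_strategies measurable_fair]])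
  also have "\<dots> = mutual_info \<beta> M X Y fX fXY"
    unfolding mutual_info_def using measurable_space[OF measurable_XY]
    by (intro ereal_integral_cong_AE) (auto simp: round_gain_def fair space_pair_measure)
  finally show ?thesis .
qed

text \<open>At fair odds the gain of \<open>fXY\<close> is almost surely log (fXY / fX), the log
  ratio against the strategy that bets \<open>fX\<close> and ignores y; Gibbs' inequality controls
  its negative part.\<close>

lemma quasi_integrable_fair: "quasi_integrable joint_law (round_gain odds fXY)"
proof (rule quasi_integrable_mono[OF quasi_integrable_log_ratio[OF marginal_in_strategies]])
  show "round_gain odds fXY \<in> borel_measurable joint_law"
    using measurable_round_gain[OF conditional_pdf_in_strategies measurable_fair] by simp
  show "AE z in joint_law. log_ratio (\<lambda>_. fX) z \<le> round_gain odds fXY z"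
    using AE_joint_law_pos
    by eventually_elim (auto simp: log_ratio_def round_gain_def elog_def fair log_divide base)
qed

text \<open>The second assumption excludes \<infinity> - \<infinity>. If the gain of
  \<open>b\<close> is quasi-integrable, the sum formula can be solved for it; otherwise the gain is
  \<open>- \<infinity>\<close>, and it remains to see that the divergence is infinite.\<close>

lemma expected_gain_fair_eq:
  assumes b: "b \<in> strategies S T"
    and "\<not> (mutual_info \<beta> M X Y fX fXY = \<infinity> \<and> conditional_KL b = \<infinity>)"
  shows "expected_gain odds b = mutual_info \<beta> M X Y fX fXY - conditional_KL b"
proof (cases "quasi_integrable joint_law (round_gain odds b)")
  case True
  have "mutual_info \<beta> M X Y fX fXY = expected_gain odds b + conditional_KL b"
    using expected_gain_conditional_pdf[OF b measurable_fair fair_nonneg True]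
    by (simp add: expected_gain_fair)
  then show ?thesis
    using assms(2) conditional_KL_nonneg[OF b] expected_gain_neq_minus_infty[OF True]
    by (cases "expected_gain odds b"; cases "conditional_KL b") auto
next
  case False
  \<comment> \<open>A finite divergence would make the negated log ratio quasi-integrable, and
    adding the quasi-integrable gain of \<open>fXY\<close> would give a quasi-integrable lower bound
    for the gain of \<open>b\<close>.\<close>
  have "conditional_KL b = \<infinity>"
  proof (rule ccontr)
    assume fin: "conditional_KL b \<noteq> \<infinity>"
    note qi = quasi_integrable_log_ratio[OF b]
    have "x < \<infinity>" if "enn2ereal x - enn2ereal y \<noteq> \<infinity>" "y < \<infinity>" for x y
      using that by (cases x; cases y) auto
    then have "(\<integral>\<^sup>+z. e2ennreal (log_ratio b z) \<partial>joint_law) < \<infinity>"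
      using fin qi unfolding ereal_integral_log_ratio[OF b, symmetric] ereal_integral_quasi_integrable[OF qi]
      by (simp add: quasi_integrable_def)
    then have "quasi_integrable joint_law (\<lambda>z. - log_ratio b z)"
      using qi by (simp add: quasi_integrable_def)
    note sum = ereal_integral_add(1)[OF quasi_integrable_fair this]
    have "AE z in joint_law. round_gain odds fXY z + - log_ratio b z \<le> round_gain odds b z"
      using AE_joint_law_pos
    proof eventually_elim
      case (elim z)
      show ?case
      \<comment> \<open>Where \<open>b\<close> is 0 the log ratio is \<open>\<infinity>\<close>, so
        the left side is \<open>- \<infinity>\<close> because the gain of \<open>fXY\<close> is
        never \<open>\<infinity>\<close>.\<close>
      proof (cases "b (snd z) (fst z) = 0")
        case True
        then show ?thesis
          using elim round_gain_neq_infty[of odds fXY z]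
            by (cases "round_gain odds fXY z") (simp_all add: log_ratio_def elog_def)
      next
        case False
        then have "0 < b (snd z) (fst z)"
          using elim strategies_nonneg[OF b, of "fst z" "snd z"] by (auto simp: mem_Times_iff)
        moreover have "odds (fst z) = 1 / fX (fst z)"
          using elim fair by (simp add: mem_Times_iff)
        ultimately show ?thesis
          using elim base by (simp add: log_ratio_def round_gain_def elog_def log_divide)
      qed
    qed
    then have "quasi_integrable joint_law (round_gain odds b)"
      using measurable_round_gain[OF b measurable_fair] by (intro quasi_integrable_mono[OF sum]) auto
    with False show False by simp
  qed
  moreover from this have "mutual_info \<beta> M X Y fX fXY \<noteq> \<infinity>"
    using assms(2) by simp
  ultimately show ?thesis
    unfolding expected_gain_eq_minus_infty[OF b measurable_fair False]
    by (cases "mutual_info \<beta> M X Y fX fXY") simp_all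
qed

end

section \<open>Restricted sets of betting functions\<close>

lemma strategies_in_mono: "B \<subseteq> betting_functions S \<Longrightarrow> b \<in> strategies_in S T B \<Longrightarrow> b \<in> strategies S T"
  by (auto simp: strategies_in_def)

abbreviation minimizes where
  "minimizes B b \<equiv> AE y in distr M T Y. is_arg_min (KL_div \<beta> S (fXY y)) (\<lambda>g. g \<in> B) (b y)"

text \<open>For uncountable \<open>B\<close> the infimum is not evidently measurable in y. Once some
  strategy minimizes for almost every y, the integrand agrees almost everywhere with the measurable
  one of that strategy.\<close>

definition loss where
  "loss B = ereal_integral T (\<lambda>y. ereal (fY y) * (INF g\<in>B. KL_div \<beta> S (fXY y) g))"

lemma AE_eq_Inf_if_minimizes:
  assumes "minimizes B b"
  shows "AE y in T. ereal (fY y) * (INF g\<in>B. KL_div \<beta> S (fXY y) g) =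
    ereal (fY y) * KL_div \<beta> S (fXY y) (b y)"
  using assms AE_space unfolding AE_Y
proof eventually_elim
  case (elim y)
  show ?case
  proof (cases "0 < fY y")
    case True
    with elim have "is_arg_min (KL_div \<beta> S (fXY y)) (\<lambda>g. g \<in> B) (b y)" by blast
    then have "(INF g\<in>B. KL_div \<beta> S (fXY y) g) = KL_div \<beta> S (fXY y) (b y)"
      by (intro antisym INF_lower INF_greatest) (auto simp: is_arg_min_def not_less)
    then show ?thesis by simp
  next
    case False
    with elim fY_nonneg[of y] have "fY y = 0" by auto
    then show ?thesis by (simp flip: zero_ereal_def)
  qed
qed

lemma loss_eq: "minimizes B b \<Longrightarrow> loss B = conditional_KL b"
  unfolding loss_def conditional_KL_def by (rule ereal_integral_cong_AE) (rule AE_eq_Inf_if_minimizes)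

lemma Inf_KL_le:
  assumes "b \<in> strategies_in S T B" "y \<in> space T"
  shows "ereal (fY y) * (INF g\<in>B. KL_div \<beta> S (fXY y) g) \<le> ereal (fY y) * KL_div \<beta> S (fXY y) (b y)"
  using assms strategies_inD(2)[OF assms] fY_nonneg by (intro ereal_mult_left_mono INF_lower) auto

lemma loss_le: "b \<in> strategies_in S T B \<Longrightarrow> loss B \<le> conditional_KL b"
  unfolding loss_def conditional_KL_def by (rule ereal_integral_mono) (auto intro: Inf_KL_le)

text \<open>The comparison is with the minimizing strategy \<open>b0\<close>, whose integrand is
  measurable, instead of the infimum. Equal finite integrals of ordered integrands agree almost
  everywhere, so \<open>b\<close> attains the infimum wherever \<open>fY\<close> is
  positive.\<close>

lemma minimizes_if_eq_loss:
  assumes B: "B \<subseteq> betting_functions S" and b0: "b0 \<in> strategies_in S T B" "minimizes B b0"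
    and b: "b \<in> strategies_in S T B" and eq: "conditional_KL b = loss B" and fin: "\<bar>loss B\<bar> \<noteq> \<infinity>"
  shows "minimizes B b"
proof -
  let ?f = "\<lambda>b y. ereal (fY y) * KL_div \<beta> S (fXY y) (b y)"
  let ?m = "\<lambda>y. ereal (fY y) * (INF g\<in>B. KL_div \<beta> S (fXY y) g)"
  note b0' = strategies_in_mono[OF B b0(1)] and b' = strategies_in_mono[OF B b]
  note m0 = AE_eq_Inf_if_minimizes[OF b0(2)]
  have [measurable]: "?f b0 \<in> borel_measurable T" "?f b \<in> borel_measurable T"
    using measurable_KL_div[OF b0'] measurable_KL_div[OF b'] by measurable
  have "AE y in T. ?m y \<le> ?f b y"
    using Inf_KL_le[OF b] by auto
  with m0 have le: "AE y in T. ?f b0 y \<le> ?f b y"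
    by eventually_elim simp
  have "quasi_integrable T (?f b0)"
    using conditional_KL_integrand_nonneg[OF b0'] by (intro quasi_integrable_nonneg) auto
  then have "AE y in T. ?f b0 y = ?f b y"
    using le eq fin unfolding loss_eq[OF b0(2)] conditional_KL_def
    by (intro ereal_integral_eq_imp_AE_eq) auto
  with m0 show ?thesis
    unfolding AE_Y using AE_space
  proof eventually_elim
    case (elim y)
    show ?case
    proof
      assume "0 < fY y"
      moreover have "?m y = ?f b y"
        using elim by simp
      ultimately have "(INF g\<in>B. KL_div \<beta> S (fXY y) g) = KL_div \<beta> S (fXY y) (b y)"
        by (simp add: ereal_mult_cancel_left)
      then have "KL_div \<beta> S (fXY y) (b y) \<le> KL_div \<beta> S (fXY y) g" if "g \<in> B" for g
        using that by (metis INF_lower)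
      then show "is_arg_min (KL_div \<beta> S (fXY y)) (\<lambda>g. g \<in> B) (b y)"
        using strategies_inD(2)[OF b elim(3)] by (auto simp: is_arg_min_def not_less)
    qed
  qed
qed

text \<open>Passage from n rounds to one: the logarithm of the wealth is a sum of i.i.d. gains, with
  ruin in any round giving \<open>- \<infinity>\<close> on both sides.\<close>

lemma expected_log_wealth_eq:
  assumes "indep_vars (\<lambda>_. S \<Otimes>\<^sub>M T) (\<lambda>i w. (Xs i w, Ys i w)) {1..n}" "1 \<le> n"
    and "\<And>i. i \<in> {1..n} \<Longrightarrow> distr M (S \<Otimes>\<^sub>M T) (\<lambda>w. (Xs i w, Ys i w)) = joint_law"
    and odds: "odds \<in> borel_measurable S" "\<forall>x\<in>space S. 0 \<le> odds x"
    and b: "b \<in> strategies S T"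
  shows "expected_log_wealth \<beta> M Xs Ys odds n b = ereal (real n) * expected_gain odds b"
proof -
  have "elog \<beta> (wealth Xs Ys odds n b w) = (\<Sum>i\<in>{1..n}. round_gain odds b (Xs i w, Ys i w))"
    if "w \<in> space M" for w
  proof -
    have "Xs i w \<in> space S \<and> Ys i w \<in> space T" if "i \<in> {1..n}" for i
      using assms(1) that \<open>w \<in> space M\<close> measurable_space[of "\<lambda>w. (Xs i w, Ys i w)" M "S \<Otimes>\<^sub>M T" w]
      by (auto simp: indep_vars_def space_pair_measure)
    then show ?thesis
      unfolding wealth_def round_gain_def
      by (subst elog_prod) (auto simp: base strategies_nonneg[OF b] odds(2))
  qed
  then have "expected_log_wealth \<beta> M Xs Ys odds n b =
      ereal_integral M (\<lambda>w. \<Sum>i\<in>{1..n}. round_gain odds b (Xs i w, Ys i w))"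
    unfolding expected_log_wealth_def by (intro ereal_integral_cong_AE AE_I2) auto
  also have "\<dots> = ereal (real (card {1..n})) * expected_gain odds b"
    unfolding expected_gain_def
    by (rule ereal_integral_sum_iid[OF _ _ assms(1)])
       (use assms(2,3) measurable_round_gain[OF b odds(1)] in \<open>auto simp: round_gain_neq_infty\<close>)
  finally show ?thesis by simp
qed

end

theorem mainTheorem7:
  fixes M :: "'w measure"
    and \<X> :: "'a::euclidean_space set" and \<Y> :: "'b::euclidean_space set"
    and X :: "'w \<Rightarrow> 'a" and Y :: "'w \<Rightarrow> 'b"
    and Xs :: "nat \<Rightarrow> 'w \<Rightarrow> 'a" and Ys :: "nat \<Rightarrow> 'w \<Rightarrow> 'b"
    and fX :: "'a \<Rightarrow> real" and fY :: "'b \<Rightarrow> real" and fXY :: "'b \<Rightarrow> 'a \<Rightarrow> real"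
    and odds :: "'a \<Rightarrow> real" and \<beta> :: real and n :: nat
  defines "S \<equiv> lborel_on \<X>" and "T \<equiv> lborel_on \<Y>"
  defines "E \<equiv> expected_log_wealth \<beta> M Xs Ys odds n"
    and "W \<equiv> growth_rate \<beta> M Xs Ys odds n"
    and "I \<equiv> mutual_info \<beta> M X Y fX fXY"
  assumes "prob_space M" and "1 < \<beta>" and "1 \<le> n"
    and "\<X> \<in> sets borel" and "\<Y> \<in> sets borel"
    and "pdf M S X fX" and "pdf M T Y fY" and "conditional_pdf M S T X Y fY fXY"
    and "prob_space.indep_vars M (\<lambda>_. S \<Otimes>\<^sub>M T) (\<lambda>i w. (Xs i w, Ys i w)) {1..n}"
    and "\<And>i. i \<in> {1..n} \<Longrightarrow>
      distr M (S \<Otimes>\<^sub>M T) (\<lambda>w. (Xs i w, Ys i w)) = distr M (S \<Otimes>\<^sub>M T) (\<lambda>w. (X w, Y w))"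
    and "odds \<in> borel_measurable S" and "\<And>x. x \<in> \<X> \<Longrightarrow> 0 \<le> odds x"
  shows "(is_arg_max E (\<lambda>b. b \<in> strategies S T) fXY \<and>
          (\<bar>E fXY\<bar> \<noteq> \<infinity> \<longrightarrow>
            (\<forall>b. is_arg_max E (\<lambda>b. b \<in> strategies S T) b \<longrightarrow>
              (AE y in distr M T Y. AE x in S. b y x = fXY y x))))
    \<and> ((\<forall>x\<in>\<X>. odds x = 1 / fX x) \<longrightarrow> is_maximum (W ` strategies S T) I)
    \<and> ((\<forall>x\<in>\<X>. odds x = 1 / fX x) \<longrightarrow>
        (\<forall>B \<subseteq> betting_functions S.
          let optimal = is_arg_max W (\<lambda>b. b \<in> strategies_in S T B);
              minimizes = (\<lambda>b. AE y in distr M T Y. is_arg_min (KL_div \<beta> S (fXY y)) (\<lambda>g. g \<in> B) (b y));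
              loss = ereal_integral T (\<lambda>y. ereal (fY y) * (INF g\<in>B. KL_div \<beta> S (fXY y) g))
          in (\<exists>b\<in>strategies_in S T B. minimizes b) \<longrightarrow> \<not> (I = \<infinity> \<and> loss = \<infinity>) \<longrightarrow>
             is_maximum (W ` strategies_in S T B) (I - loss) \<and>
             (\<forall>b\<in>strategies_in S T B. minimizes b \<longrightarrow> optimal b) \<and>
             (\<bar>I - loss\<bar> \<noteq> \<infinity> \<longrightarrow> (\<forall>b. optimal b \<longrightarrow> minimizes b))))"
proof -
  have spS: "space S = \<X>" and spT: "space T = \<Y>"
    by (simp_all add: S_def T_def space_restrict_space)
  interpret prob_space M by fact
  interpret S: sigma_finite_measure S
    unfolding S_def using assms by (intro sigma_finite_measure_restrict_space sigma_finite_lborel) auto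
  interpret T: sigma_finite_measure T
    unfolding T_def using assms by (intro sigma_finite_measure_restrict_space sigma_finite_lborel) auto
  interpret side_information M S T X Y fX fY fXY \<beta>
    by unfold_locales fact+
  have odds0: "\<forall>x\<in>space S. 0 \<le> odds x"
    using assms spS by auto
  let ?G = "expected_gain odds"
  have E: "E b = ereal (real n) * ?G b" if "b \<in> strategies S T" for b
    unfolding E_def by (rule expected_log_wealth_eq) (use assms odds0 that in auto)
  have W: "W b = ?G b" if "b \<in> strategies S T" for b
    using E[OF that] \<open>1 \<le> n\<close>
    by (simp add: W_def E_def growth_rate_def flip: mult.assoc one_ereal_def)
  note odds = \<open>odds \<in> borel_measurable S\<close> odds0
  note fXYs = conditional_pdf_in_strategies

  \<comment> \<open>Unrestricted strategies: optimality, uniqueness, value at fair odds\<close>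
  have optimal: "is_arg_max E (\<lambda>b. b \<in> strategies S T) fXY"
    using fXYs E expected_gain_le[OF _ odds]
    by (auto simp: is_arg_max_def not_less intro!: ereal_mult_left_mono)
  have unique: "AE y in distr M T Y. AE x in S. b y x = fXY y x"
    if fin: "\<bar>E fXY\<bar> \<noteq> \<infinity>" and max: "is_arg_max E (\<lambda>b. b \<in> strategies S T) b" for b
  proof -
    have b: "b \<in> strategies S T" and le: "E fXY \<le> E b"
      using max fXYs by (auto simp: is_arg_max_def not_less)
    from le have "ereal (real n) * ?G fXY = ereal (real n) * ?G b"
      unfolding E[OF b] E[OF fXYs]
      by (rule antisym) (intro ereal_mult_left_mono expected_gain_le[OF b odds], simp)
    then have "?G b = ?G fXY"
      using \<open>1 \<le> n\<close> by (simp add: ereal_mult_cancel_left)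
    moreover have "\<bar>?G fXY\<bar> \<noteq> \<infinity>"
      using fin E[OF fXYs] \<open>1 \<le> n\<close> by auto
    ultimately show ?thesis
      using expected_gain_eqD[OF b odds] by simp
  qed
  have maximum: "is_maximum (W ` strategies S T) I" if "\<forall>x\<in>\<X>. odds x = 1 / fX x"
  proof -
    have "W fXY = I"
      using expected_gain_fair[of odds] that spS W[OF fXYs] by (simp add: I_def)
    then show ?thesis
      using fXYs W expected_gain_le[OF _ odds] by (auto simp: is_maximum_def image_iff)
  qed

  \<comment> \<open>Strategies confined to a given set\<close>
  have restricted: "is_maximum (W ` strategies_in S T B) (I - loss B) \<and>
      (\<forall>b\<in>strategies_in S T B. minimizes B b \<longrightarrow> is_arg_max W (\<lambda>b. b \<in> strategies_in S T B) b) \<and>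
      (\<bar>I - loss B\<bar> \<noteq> \<infinity> \<longrightarrow>
        (\<forall>b. is_arg_max W (\<lambda>b. b \<in> strategies_in S T B) b \<longrightarrow> minimizes B b))"
    if fair: "\<forall>x\<in>\<X>. odds x = 1 / fX x" and B: "B \<subseteq> betting_functions S"
      and ex: "\<exists>b\<in>strategies_in S T B. minimizes B b" and I: "\<not> (I = \<infinity> \<and> loss B = \<infinity>)" for B
  proof -
    obtain b0 where b0: "b0 \<in> strategies_in S T B" "minimizes B b0"
      using ex by blast
    note mono = strategies_in_mono[OF B]
    have fair': "\<forall>x\<in>space S. odds x = 1 / fX x"
      using fair spS by auto
    have eq: "W b = I - conditional_KL b"
      if "b \<in> strategies_in S T B" "\<not> (I = \<infinity> \<and> conditional_KL b = \<infinity>)" for b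
      using expected_gain_fair_eq[OF fair' mono[OF that(1)]] that(2) W[OF mono[OF that(1)]]
      by (simp add: I_def)
    have opt: "W b = I - loss B" if "b \<in> strategies_in S T B" "minimizes B b" for b
      using eq[OF that(1)] loss_eq[OF that(2)] I by auto
    have le: "W b \<le> I - loss B" if "b \<in> strategies_in S T B" for b
    \<comment> \<open>If \<open>I\<close> is infinite, the assumption \<open>I\<close> keeps the
      loss below \<open>\<infinity>\<close> and the claimed bound is \<open>\<infinity>\<close>.
      Otherwise the formula for \<open>W b\<close> is available and the loss is at most the
      conditional divergence.\<close>
    proof (cases "I = \<infinity>")
      case True
      then show ?thesis using I by (cases "loss B") auto
    next
      case False
      then show ?thesis
        using eq[OF that] loss_le[OF that] by (auto intro: ereal_minus_mono)
    qed
    have "minimizes B b" if fin: "\<bar>I - loss B\<bar> \<noteq> \<infinity>"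
      and max: "is_arg_max W (\<lambda>b. b \<in> strategies_in S T B) b" for b
    proof -
      have b: "b \<in> strategies_in S T B" and "W b0 \<le> W b"
        using max b0(1) by (auto simp: is_arg_max_def not_less)
      then have "W b = I - loss B"
        using le[OF b] opt[OF b0] by auto
      \<comment> \<open>A finite difference has finite terms, so \<open>I\<close> can be cancelled
        and \<open>b\<close> has exactly the minimal loss.\<close>
      moreover have "\<bar>I\<bar> \<noteq> \<infinity>" "\<bar>loss B\<bar> \<noteq> \<infinity>"
        using fin by (cases I; cases "loss B"; auto)+
      ultimately have "conditional_KL b = loss B"
        using eq[OF b] by (cases I; cases "loss B"; cases "conditional_KL b") auto
      then show ?thesis
        using minimizes_if_eq_loss[OF B b0 b] \<open>\<bar>loss B\<bar> \<noteq> \<infinity>\<close> by simp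
    qed
    moreover have "is_maximum (W ` strategies_in S T B) (I - loss B)"
      using opt[OF b0] b0(1) le by (auto simp: is_maximum_def image_iff intro!: bexI[of _ b0])
    moreover have "is_arg_max W (\<lambda>b. b \<in> strategies_in S T B) b"
      if "b \<in> strategies_in S T B" "minimizes B b" for b
      using opt[OF that] le that(1) by (auto simp: is_arg_max_def not_less)
    ultimately show ?thesis
      by (intro conjI ballI allI impI)
  qed
  show ?thesis
    unfolding Let_def loss_def[symmetric]
    apply (intro conjI)
       apply (rule optimal)
      apply (intro impI allI, rule unique; assumption)
     apply (intro impI, rule maximum, assumption)
    apply (intro impI allI, rule restricted; assumption)
    done
qed

end
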